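(* Consider the block-structured linear program $\max \sum_{i=1}^n c_i^T x^{(i)}$ subject to $\sum_{i=1}^n A_i x^{(i)}=b_0$, $x^{(i)}\in Q_i$, and the integer program additionally requiring $x^{(i)}\in\mathbb{Z}^{t_i}$, where $A_i\in\mathbb{Z}^{r\times t_i}$ have entries of absolute value at most $\Delta$, $b_0\in\mathbb{Z}^r$, and $Q_i=\operatorname{conv}\{x\in\mathbb{Z}^{t_i}: B_ix=b_i,\ x\ge0\}$ for integral $B_i,b_i$, with $G$ an upper bound on the $\ell_1$-norm of every Graver basis element of every $B_i$. Let $x^*$ be an optimal vertex solution of the linear program; for each $i$ let $F_i$ be the minimal face of $Q_i$ containing $x^{*(i)}$, and let $y^{*(i)}$ be an integer point of $F_i$ nearest to $x^{*(i)}$ in $\ell_1$-norm among $F_i\cap\mathbb{Z}^{t_i}$; write $y^*=(y^{*(1)},\dots,y^{*(n)})$. Suppose $z^*$ is an optimal solution of the integer program that is closest to $y^*$ in $\ell_1$-norm among all optimal solutions. Then \[ \|y^*-z^*\|_1\le (2r\Delta G+1)^{r+4}. \]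
   Context: The Graver basis of an integer matrix $C$ is the set of nonzero integral vectors $u\in\ker(C)$ that cannot be written as $u=v+w$ with $v,w$ nonzero integral elements of $\ker(C)$ that are sign-compatible ($v_jw_j\ge0$ for all $j$). *)

theory Defs
  imports "HOL-Analysis.Analysis"
begin

text \<open>
  The blocks have different widths \<open>t\<^sub>i\<close>, so a block is given by a set \<open>J\<close> of coordinates of a
  common finite index type: the space of vectors indexed by \<open>J\<close> is represented by the vectors
  vanishing outside \<open>J\<close>. Likewise, the rows of a matrix with a block-dependent height are given by
  a set \<open>K\<close>. Entries of a matrix outside \<open>K \<times> J\<close> are irrelevant.
\<close>

definition vecs_on :: "'t set \<Rightarrow> ('a::zero ^ 't::finite) set" where
  "vecs_on J = {x. \<forall>j. j \<notin> J \<longrightarrow> x $ j = 0}"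

definition real_vec :: "int ^ 't \<Rightarrow> real ^ 't::finite" where
  "real_vec u = (\<chi> j. real_of_int (u $ j))"

definition real_mat :: "int ^ 't ^ 'm \<Rightarrow> real ^ 't::finite ^ 'm::finite" where
  "real_mat C = (\<chi> k. real_vec (C $ k))"

definition integral_vec :: "real ^ 't::finite \<Rightarrow> bool" where
  "integral_vec x \<longleftrightarrow> (\<forall>j. x $ j \<in> \<int>)"

definition l1_norm :: "'a::{comm_monoid_add, abs} ^ 't::finite \<Rightarrow> 'a" where
  "l1_norm x = (\<Sum>j\<in>UNIV. \<bar>x $ j\<bar>)"

definition block_l1_norm :: "real ^ 't::finite ^ 'n::finite \<Rightarrow> real" where
  "block_l1_norm x = (\<Sum>i\<in>UNIV. l1_norm (x $ i))"

definition int_kernel :: "'t set \<Rightarrow> 'm set \<Rightarrow> int ^ 't ^ 'm \<Rightarrow> (int ^ 't::finite) set" where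
  "int_kernel J K C = {u \<in> vecs_on J. \<forall>k\<in>K. (C *v u) $ k = 0}"

definition graver_basis :: "'t set \<Rightarrow> 'm set \<Rightarrow> int ^ 't ^ 'm \<Rightarrow> (int ^ 't::finite) set" where
  "graver_basis J K C =
     {u \<in> int_kernel J K C. u \<noteq> 0 \<and>
        \<not> (\<exists>v \<in> int_kernel J K C. \<exists>w \<in> int_kernel J K C.
             v \<noteq> 0 \<and> w \<noteq> 0 \<and> (\<forall>j. 0 \<le> v $ j * w $ j) \<and> u = v + w)}"

definition integer_hull ::
  "'t set \<Rightarrow> 'm set \<Rightarrow> int ^ 't ^ 'm \<Rightarrow> int ^ 'm \<Rightarrow> (real ^ 't::finite) set" where
  "integer_hull J K C d =
     convex hull (real_vec ` {u \<in> vecs_on J. (\<forall>k\<in>K. (C *v u) $ k = d $ k) \<and> (\<forall>j. 0 \<le> u $ j)})"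

definition minimal_face :: "'a::real_vector set \<Rightarrow> 'a \<Rightarrow> 'a set \<Rightarrow> bool" where
  "minimal_face Q x F \<longleftrightarrow>
     F face_of Q \<and> x \<in> F \<and> (\<forall>F'. F' face_of Q \<and> x \<in> F' \<longrightarrow> F \<subseteq> F')"

definition objective :: "real ^ 't::finite ^ 'n::finite \<Rightarrow> real ^ 't ^ 'n \<Rightarrow> real" where
  "objective c x = (\<Sum>i\<in>UNIV. c $ i \<bullet> x $ i)"

definition lp_feasible ::
  "('n::finite \<Rightarrow> int ^ 't ^ 'r) \<Rightarrow> int ^ 'r \<Rightarrow> ('n \<Rightarrow> (real ^ 't) set)
     \<Rightarrow> (real ^ 't::finite ^ 'n) set" where
  "lp_feasible A b0 Q =
     {x. (\<Sum>i\<in>UNIV. real_mat (A i) *v (x $ i)) = real_vec b0 \<and> (\<forall>i. x $ i \<in> Q i)}"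

definition ip_feasible ::
  "('n::finite \<Rightarrow> int ^ 't ^ 'r) \<Rightarrow> int ^ 'r \<Rightarrow> ('n \<Rightarrow> (real ^ 't) set)
     \<Rightarrow> (real ^ 't::finite ^ 'n) set" where
  "ip_feasible A b0 Q = {x \<in> lp_feasible A b0 Q. \<forall>i. integral_vec (x $ i)}"

end

theory Submission
  imports Defs
begin

text \<open>
  Decompose \<open>z\<^sub>i - y\<^sub>i\<close> sign-compatibly into Graver basis elements. If the images under the \<open>A\<^sub>i\<close> of
  some nonempty subfamily summed to zero, its sum \<open>w\<close> could be subtracted from \<open>z\<close>, and, as \<open>y\<^sub>i\<close>
  lies in the minimal face of \<open>x\<^sub>i\<close>, a small multiple of it could be added to \<open>x\<close>; optimality
  of \<open>x\<close> and \<open>z\<close> then makes \<open>z - w\<close> an optimal solution closer to \<open>y\<close>. So the images form a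
  zero-sum-free family of integer vectors of entries at most \<open>\<Delta>G\<close>, and its sum
  \<open>\<Sum>\<^sub>i A\<^sub>i (x\<^sub>i - y\<^sub>i)\<close> has entries at most \<open>r\<Delta>G\<close>, because \<open>x\<close> is a vertex and therefore within
  distance \<open>rG\<close> of lattice points of the faces. Ordered by the Steinitz lemma, all prefix sums
  stay in a box with \<open>(2r\<Delta>G + 1)\<^sup>r\<close> lattice points, and hardly any of them can be repeated.
\<close>

section \<open>The Steinitz lemma\<close>

text \<open>The vertex \<open>x\<close> may be fractional, so \<open>z - x\<close> has no
  decomposition into Graver elements. The lattice point \<open>y\<close> takes its place and serves
  twice: lying in the minimal faces, it passes its feasible directions on to \<open>x\<close>; lying
  near \<open>x\<close>, it bounds the total image, since \<open>x\<close> and \<open>z\<close>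
  satisfy the same coupling constraint and the bound must not grow with the number of blocks. The
  distance r G arises blockwise: it is controlled by Graver elements with disjoint supports, along
  each of which \<open>x\<close> can move both ways. More than r of them in total would have
  dependent images in r dimensions, against extremality. Steinitz needs total zero, hence r appended
  vectors; a prefix is identified by its sum and by the number of appended vectors in it, which
  takes r + 1 values. Write P = 2 r \<Delta> G + 1 with \<Delta> and G rounded down. Unless \<Delta>
  G vanishes, r + 1 and G are at most P, so there are at most P * P^r Graver elements of norm at
  most P each: a power r + 2, within the claimed r + 4.\<close>

lemma dependent_family:
  fixes v :: "'e \<Rightarrow> 'a::euclidean_space"
  assumes "finite S" "card S > DIM('a)"
  obtains \<alpha> where "\<exists>e\<in>S. \<alpha> e \<noteq> 0" "(\<Sum>e\<in>S. \<alpha> e *\<^sub>R v e) = 0"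
proof (cases "inj_on v S")
  case True
  then have "dependent (v ` S)"
    using assms by (intro dependent_biggerset) (auto simp: card_image)
  then obtain u where u: "\<exists>x\<in>v ` S. u x \<noteq> 0" "(\<Sum>x\<in>v ` S. u x *\<^sub>R x) = 0"
    using dependent_finite[of "v ` S"] assms(1) by auto
  show thesis
    by (rule that[of "u \<circ> v"]) (use u in \<open>auto simp: sum.reindex[OF True]\<close>)
next
  case False
  then obtain a b where ab: "a \<in> S" "b \<in> S" "a \<noteq> b" "v a = v b"
    by (auto simp: inj_on_def)
  let ?\<alpha> = "\<lambda>e. if e = a then 1 else if e = b then -1 else 0 :: real"
  have "(\<Sum>e\<in>S. ?\<alpha> e *\<^sub>R v e) = (\<Sum>e\<in>{a, b}. ?\<alpha> e *\<^sub>R v e)"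
    using assms ab by (intro sum.mono_neutral_right) auto
  also have "\<dots> = 0"
    using ab by simp
  finally show thesis
    by (intro that[of ?\<alpha>]) (use ab in auto)
qed

text \<open>This is the count of fractional coordinates in a basic solution: as long as more than
  \<open>DIM('a)\<close> weights are strictly between 0 and 1, a linear dependence among their
  vectors allows a move that makes one of them 0 or 1.\<close>

lemma exists_few_fractional:
  fixes v :: "'e \<Rightarrow> 'a::euclidean_space" and \<nu> :: "'e \<Rightarrow> real"
  assumes "finite S" "\<forall>e\<in>S. 0 \<le> \<nu> e \<and> \<nu> e \<le> 1"
  obtains \<mu> where "\<forall>e\<in>S. 0 \<le> \<mu> e \<and> \<mu> e \<le> 1"
    "(\<Sum>e\<in>S. \<mu> e *\<^sub>R v e) = (\<Sum>e\<in>S. \<nu> e *\<^sub>R v e)"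
    "card {e\<in>S. \<mu> e \<noteq> 0 \<and> \<mu> e \<noteq> 1} \<le> DIM('a)"
proof -
  have "\<exists>\<mu>. (\<forall>e\<in>S. 0 \<le> \<mu> e \<and> \<mu> e \<le> 1) \<and>
    (\<Sum>e\<in>S. \<mu> e *\<^sub>R v e) = (\<Sum>e\<in>S. \<nu> e *\<^sub>R v e) \<and>
    card {e\<in>S. \<mu> e \<noteq> 0 \<and> \<mu> e \<noteq> 1} \<le> DIM('a)"
    using assms(2)
  proof (induction "card {e\<in>S. \<nu> e \<noteq> 0 \<and> \<nu> e \<noteq> 1}" arbitrary: \<nu> rule: less_induct)
    case less
    let ?F = "{e\<in>S. \<nu> e \<noteq> 0 \<and> \<nu> e \<noteq> 1}"
    show ?case
    proof (cases "card ?F \<le> DIM('a)")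
      case True
      then show ?thesis using less.prems by blast
    next
      case False
      have finF: "finite ?F" using assms(1) by simp
      obtain \<alpha>0 where \<alpha>0: "\<exists>e\<in>?F. \<alpha>0 e \<noteq> 0" "(\<Sum>e\<in>?F. \<alpha>0 e *\<^sub>R v e) = 0"
        using dependent_family[OF finF, of v] False by (auto simp: not_le)
      define \<alpha> where "\<alpha> e = (if e \<in> ?F then \<alpha>0 e else 0)" for e
      have \<alpha>sum: "(\<Sum>e\<in>S. \<alpha> e *\<^sub>R v e) = 0"
      proof -
        have "(\<Sum>e\<in>S. \<alpha> e *\<^sub>R v e) = (\<Sum>e\<in>?F. \<alpha> e *\<^sub>R v e)"
          using assms(1) by (intro sum.mono_neutral_right) (auto simp: \<alpha>_def)
        also have "\<dots> = (\<Sum>e\<in>?F. \<alpha>0 e *\<^sub>R v e)"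
          by (intro sum.cong) (auto simp: \<alpha>_def)
        finally show ?thesis using \<alpha>0 by simp
      qed
      define N where "N = {e\<in>?F. \<alpha> e \<noteq> 0}"
      have N: "finite N" "N \<noteq> {}" using finF \<alpha>0(1) by (auto simp: N_def \<alpha>_def)
      \<comment> \<open>The step length at which the weight of \<open>e\<close> reaches 1 (if
        increasing) or 0 (if decreasing); the smallest one keeps all weights in range.\<close>
      define t where "t e = (if \<alpha> e > 0 then (1 - \<nu> e) / \<alpha> e else \<nu> e / (- \<alpha> e))" for e
      obtain a where a: "a \<in> N" "\<And>e. e \<in> N \<Longrightarrow> t a \<le> t e"
        using arg_min_least[OF N] arg_min_if_finite(1)[OF N] by blast
      define \<mu> where "\<mu> e = \<nu> e + t a * \<alpha> e" for e
      have F01: "0 < \<nu> e" "\<nu> e < 1" if "e \<in> ?F" for e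
        using that less.prems by (force simp: less_le)+
      have ta: "t a > 0"
        using a(1) F01[of a] by (auto simp: t_def N_def divide_simps)
      have bounds: "0 \<le> \<mu> e \<and> \<mu> e \<le> 1" if "e \<in> S" for e
      proof (cases "e \<in> N")
        case False
        then have "\<alpha> e = 0" using that by (auto simp: N_def \<alpha>_def)
        then show ?thesis using less.prems that by (simp add: \<mu>_def)
      next
        case True
        then have eF: "e \<in> ?F" and e0: "\<alpha> e \<noteq> 0" by (auto simp: N_def)
        have le: "t a \<le> t e" using a True by blast
        show ?thesis
        proof (cases "\<alpha> e > 0")
          case True
          have "t a * \<alpha> e \<le> 1 - \<nu> e"
            using le True by (simp add: t_def pos_le_divide_eq)
          moreover have "0 \<le> t a * \<alpha> e" using ta True by simp
          ultimately show ?thesis using F01[OF eF] by (simp add: \<mu>_def)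
        next
          case False
          then have neg: "\<alpha> e < 0" using e0 by simp
          have "t a * (- \<alpha> e) \<le> \<nu> e"
            using le False neg by (simp add: t_def pos_le_divide_eq neg_le_divide_eq divide_simps)
          moreover have "t a * \<alpha> e \<le> 0" using ta neg by (simp add: mult_nonneg_nonpos)
          ultimately show ?thesis using F01[OF eF] by (simp add: \<mu>_def)
        qed
      qed
      have \<mu>a: "\<mu> a = 0 \<or> \<mu> a = 1"
        using a(1) by (auto simp: \<mu>_def t_def N_def)
      have "{e\<in>S. \<mu> e \<noteq> 0 \<and> \<mu> e \<noteq> 1} \<subset> ?F"
      proof
        show "{e\<in>S. \<mu> e \<noteq> 0 \<and> \<mu> e \<noteq> 1} \<subseteq> ?F"
          by (auto simp: \<mu>_def \<alpha>_def)
        show "{e\<in>S. \<mu> e \<noteq> 0 \<and> \<mu> e \<noteq> 1} \<noteq> ?F"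
          using \<mu>a a(1) unfolding N_def by blast
      qed
      then have lt: "card {e\<in>S. \<mu> e \<noteq> 0 \<and> \<mu> e \<noteq> 1} < card ?F"
        using finF psubset_card_mono by blast
      have "(\<Sum>e\<in>S. \<mu> e *\<^sub>R v e) = (\<Sum>e\<in>S. \<nu> e *\<^sub>R v e) + t a *\<^sub>R (\<Sum>e\<in>S. \<alpha> e *\<^sub>R v e)"
        by (simp add: \<mu>_def scaleR_add_left sum.distrib scaleR_sum_right)
      then have "(\<Sum>e\<in>S. \<mu> e *\<^sub>R v e) = (\<Sum>e\<in>S. \<nu> e *\<^sub>R v e)"
        using \<alpha>sum by simp
      then show ?thesis
        using less.hyps[OF lt] bounds by simp
    qed
  qed
  then show thesis using that by blast
qed

lemma steinitz_weights_step:
  fixes v :: "'e \<Rightarrow> real ^ 'r::finite"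
  assumes fin: "finite S" and big: "card S > CARD('r)"
    and \<nu>: "\<forall>e\<in>S. 0 \<le> \<nu> e \<and> \<nu> e \<le> 1"
    and sum1: "sum \<nu> S = real (card S) - real CARD('r)"
    and sum0: "(\<Sum>e\<in>S. \<nu> e *\<^sub>R v e) = 0"
  obtains a \<mu> where "a \<in> S" "\<forall>e\<in>S. 0 \<le> \<mu> e \<and> \<mu> e \<le> (1::real)" "\<mu> a = 0"
    "sum \<mu> S = real (card S) - 1 - real CARD('r)" "(\<Sum>e\<in>S. \<mu> e *\<^sub>R v e) = 0"
proof -
  let ?k = "real (card S)" and ?d = "real CARD('r)"
  define c where "c = (?k - 1 - ?d) / (?k - ?d)"
  have kd: "?k \<ge> ?d + 1" using big by linarith
  have c: "0 \<le> c" "c \<le> 1" using kd by (auto simp: c_def divide_simps)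
  have 1: "\<forall>e\<in>S. 0 \<le> c * \<nu> e \<and> c * \<nu> e \<le> 1"
    using \<nu> c by (auto intro!: mult_le_one)
  \<comment> \<open>Appending the coordinate 1 preserves the total weight as well, at the cost of
    one more dimension.\<close>
  obtain \<mu> where \<mu>: "\<forall>e\<in>S. 0 \<le> \<mu> e \<and> \<mu> e \<le> 1"
    "(\<Sum>e\<in>S. \<mu> e *\<^sub>R (v e, 1::real)) = (\<Sum>e\<in>S. (c * \<nu> e) *\<^sub>R (v e, 1::real))"
    "card {e\<in>S. \<mu> e \<noteq> 0 \<and> \<mu> e \<noteq> 1} \<le> DIM((real ^ 'r) \<times> real)"
    by (rule exists_few_fractional[OF fin 1, of "\<lambda>e. (v e, 1::real)"])
  have s0: "(\<Sum>e\<in>S. \<mu> e *\<^sub>R v e) = 0"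
  proof -
    have "(\<Sum>e\<in>S. \<mu> e *\<^sub>R v e) = c *\<^sub>R (\<Sum>e\<in>S. \<nu> e *\<^sub>R v e)"
      using arg_cong[OF \<mu>(2), of fst] by (simp add: fst_sum scaleR_sum_right)
    then show ?thesis using sum0 by simp
  qed
  have s1: "sum \<mu> S = ?k - 1 - ?d"
  proof -
    have "sum \<mu> S = c * sum \<nu> S"
      using arg_cong[OF \<mu>(2), of snd] by (simp add: snd_sum sum_distrib_left)
    then show ?thesis using sum1 kd by (simp add: c_def)
  qed
  \<comment> \<open>Otherwise all but at most d + 1 weights equal 1 and the others are positive, so
    the total exceeds k - (d + 1), where k is \<open>card S\<close> and d is
    \<open>CARD('r)\<close>.\<close>
  have "\<exists>a\<in>S. \<mu> a = 0"
  proof (rule ccontr)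
    assume "\<not> ?thesis"
    then have pos: "\<And>e. e \<in> S \<Longrightarrow> \<mu> e > 0" using \<mu>(1) by force
    let ?F = "{e\<in>S. \<mu> e \<noteq> 0 \<and> \<mu> e \<noteq> 1}"
    have "card (S - ?F) + card ?F = card S"
      using fin by (simp add: card_Diff_subset card_mono)
    then have cd: "real (card (S - ?F)) = ?k - real (card ?F)" by linarith
    have split: "sum \<mu> S = sum \<mu> ?F + sum \<mu> (S - ?F)"
      using fin by (subst sum.subset_diff[of ?F S]) auto
    have "sum \<mu> (S - ?F) = (\<Sum>e\<in>S - ?F. 1)"
      using pos by (intro sum.cong) force+
    then have s2: "sum \<mu> (S - ?F) = ?k - real (card ?F)"
      using cd by simp
    have F: "real (card ?F) \<le> ?d + 1" using \<mu>(3) by simp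
    show False
    proof (cases "?F = {}")
      case True
      then show False using split s2 s1 by (simp only: card.empty sum.empty)
    next
      case False
      then have "sum \<mu> ?F > 0" using fin pos by (intro sum_pos) auto
      then show False using split s2 s1 F by linarith
    qed
  qed
  then show thesis using that \<mu>(1) s0 s1 by blast
qed

text \<open>The proof of Grinberg and Sevastyanov: the order is built from its end, the weights
  \<open>\<nu>\<close> being a certificate that the sum of the remaining vectors is small.\<close>

lemma steinitz_ordering_weighted:
  fixes v :: "'e \<Rightarrow> real ^ 'r::finite"
  assumes "finite S" and bound: "\<And>e k. e \<in> S \<Longrightarrow> \<bar>v e $ k\<bar> \<le> M"
    and "card S \<ge> CARD('r) \<Longrightarrow> \<exists>\<nu>. (\<forall>e\<in>S. 0 \<le> \<nu> e \<and> \<nu> e \<le> 1) \<and>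
      sum \<nu> S = real (card S) - real CARD('r) \<and> (\<Sum>e\<in>S. \<nu> e *\<^sub>R v e) = 0"
    and "M \<ge> 0"
  shows "\<exists>es. distinct es \<and> set es = S \<and>
    (\<forall>m k. \<bar>(\<Sum>e\<in>set (take m es). v e) $ k\<bar> \<le> real CARD('r) * M)"
  using assms(1-3)
proof (induction "card S" arbitrary: S)
  case 0
  then show ?case using \<open>M \<ge> 0\<close> by (intro exI[of _ "[]"]) auto
next
  case (Suc n)
  note bnd = Suc.prems(2)
  \<comment> \<open>The vector to be placed last: the certificate must survive its removal, which is
    vacuous once fewer than \<open>CARD('r)\<close> vectors remain.\<close>
  have "\<exists>a\<in>S. (card (S - {a}) \<ge> CARD('r) \<longrightarrow> (\<exists>\<nu>. (\<forall>e\<in>S - {a}. 0 \<le> \<nu> e \<and> \<nu> e \<le> (1::real)) \<and>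
      sum \<nu> (S - {a}) = real (card (S - {a})) - real CARD('r) \<and> (\<Sum>e\<in>S - {a}. \<nu> e *\<^sub>R v e) = 0))"
  proof (cases "card S > CARD('r)")
    case False
    obtain a where "a \<in> S" using Suc.hyps(2) by fastforce
    then have "card (S - {a}) < CARD('r)"
      using False Suc.prems(1) by (metis card_Diff1_less linorder_not_less order_less_le_trans)
    then show ?thesis using \<open>a \<in> S\<close> by (intro bexI[of _ a]) auto
  next
    case True
    then obtain \<nu> where "\<forall>e\<in>S. 0 \<le> \<nu> e \<and> \<nu> e \<le> 1"
      "sum \<nu> S = real (card S) - real CARD('r)" "(\<Sum>e\<in>S. \<nu> e *\<^sub>R v e) = 0"
      using Suc.prems(3) by (auto dest: less_imp_le)
    note \<nu> = this
    obtain a \<mu> where a: "a \<in> S" "\<forall>e\<in>S. 0 \<le> \<mu> e \<and> \<mu> e \<le> (1::real)" "\<mu> a = 0"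
      "sum \<mu> S = real (card S) - 1 - real CARD('r)" "(\<Sum>e\<in>S. \<mu> e *\<^sub>R v e) = 0"
      by (rule steinitz_weights_step[OF Suc.prems(1) True \<nu>])
    have "sum \<mu> (S - {a}) = sum \<mu> S"
      using Suc.prems(1) a by (simp add: sum.remove)
    moreover have "(\<Sum>e\<in>S - {a}. \<mu> e *\<^sub>R v e) = (\<Sum>e\<in>S. \<mu> e *\<^sub>R v e)"
      using Suc.prems(1) a by (simp add: sum.remove)
    moreover have "real (card (S - {a})) = real (card S) - 1"
      using a Suc.prems(1) True by (simp add: of_nat_diff)
    ultimately show ?thesis using a by (intro bexI[of _ a]) auto
  qed
  then obtain a where a: "a \<in> S" and a\<nu>: "card (S - {a}) \<ge> CARD('r) \<Longrightarrow> (\<exists>\<nu>. (\<forall>e\<in>S - {a}. 0 \<le> \<nu> e \<and> \<nu> e \<le> (1::real)) \<and>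
      sum \<nu> (S - {a}) = real (card (S - {a})) - real CARD('r) \<and> (\<Sum>e\<in>S - {a}. \<nu> e *\<^sub>R v e) = 0)"
    by blast
  have "n = card (S - {a})" using Suc.hyps(2) a Suc.prems(1) by simp
  then obtain es where es: "distinct es" "set es = S - {a}"
    and pre: "\<And>m k. \<bar>(\<Sum>e\<in>set (take m es). v e) $ k\<bar> \<le> real CARD('r) * M"
    using Suc.hyps(1)[of "S - {a}"] Suc.prems(1) bnd a\<nu> by auto
  have total: "\<bar>(\<Sum>e\<in>S. v e) $ k\<bar> \<le> real CARD('r) * M" for k
  proof (cases "card S \<ge> CARD('r)")
    case False
    have "\<bar>(\<Sum>e\<in>S. v e) $ k\<bar> \<le> (\<Sum>e\<in>S. \<bar>v e $ k\<bar>)"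
      by (simp add: sum_abs)
    also have "\<dots> \<le> real (card S) * M"
      using bnd by (intro sum_bounded_above) auto
    also have "\<dots> \<le> real CARD('r) * M"
      using False \<open>M \<ge> 0\<close> by (intro mult_right_mono) auto
    finally show ?thesis .
  next
    case True
    then obtain \<nu> where l: "\<forall>e\<in>S. 0 \<le> \<nu> e \<and> \<nu> e \<le> 1"
      "sum \<nu> S = real (card S) - real CARD('r)" "(\<Sum>e\<in>S. \<nu> e *\<^sub>R v e) = 0"
      using Suc.prems(3) by auto
    \<comment> \<open>The coefficients \<open>1 - \<nu> e\<close> are nonnegative with total
      \<open>CARD('r)\<close>, whatever the size of \<open>S\<close>.\<close>
    have "(\<Sum>e\<in>S. v e) = (\<Sum>e\<in>S. (1 - \<nu> e) *\<^sub>R v e)"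
      using l(3) by (simp add: scaleR_diff_left sum_subtractf)
    then have "\<bar>(\<Sum>e\<in>S. v e) $ k\<bar> = \<bar>\<Sum>e\<in>S. (1 - \<nu> e) * v e $ k\<bar>"
      by simp
    also have "\<dots> \<le> (\<Sum>e\<in>S. \<bar>(1 - \<nu> e) * v e $ k\<bar>)"
      by (rule sum_abs)
    also have "\<dots> \<le> (\<Sum>e\<in>S. (1 - \<nu> e) * M)"
      using l(1) bnd by (intro sum_mono) (auto simp: abs_mult intro!: mult_left_mono)
    also have "\<dots> = real CARD('r) * M"
      using l(2) by (simp add: sum_distrib_right[symmetric] sum_subtractf)
    finally show ?thesis .
  qed
  show ?case
  proof (intro exI[of _ "es @ [a]"] conjI allI)
    show "distinct (es @ [a])" "set (es @ [a]) = S" using es a by auto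
    fix m k
    show "\<bar>(\<Sum>e\<in>set (take m (es @ [a])). v e) $ k\<bar> \<le> real CARD('r) * M"
    proof (cases "m \<le> length es")
      case True
      then show ?thesis using pre[of m k] by simp
    next
      case False
      then have "take m (es @ [a]) = es @ [a]" by simp
      then have "set (take m (es @ [a])) = S" using es(2) a by (simp only: set_append) auto
      then show ?thesis using total by simp
    qed
  qed
qed

text \<open>The equal weights (k - d) / k on k vectors in dimension d start the induction, their
  weighted sum being zero with the plain one.\<close>

lemma steinitz_ordering:
  fixes v :: "'e \<Rightarrow> real ^ 'r::finite"
  assumes "finite S" and "\<And>e k. e \<in> S \<Longrightarrow> \<bar>v e $ k\<bar> \<le> M"
    and sum0: "(\<Sum>e\<in>S. v e) = 0" and "M \<ge> 0"
  obtains es where "distinct es" "set es = S"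
    "\<And>m k. \<bar>(\<Sum>e\<in>set (take m es). v e) $ k\<bar> \<le> real CARD('r) * M"
proof -
  have "\<exists>\<nu>. (\<forall>e\<in>S. 0 \<le> \<nu> e \<and> \<nu> e \<le> 1) \<and>
      sum \<nu> S = real (card S) - real CARD('r) \<and> (\<Sum>e\<in>S. \<nu> e *\<^sub>R v e) = 0"
    if "card S \<ge> CARD('r)"
  proof (intro exI conjI)
    let ?c = "(real (card S) - real CARD('r)) / real (card S)"
    have "card S > 0" using that by (metis zero_less_card_finite order_less_le_trans)
    then show "sum (\<lambda>_. ?c) S = real (card S) - real CARD('r)"
      and "\<forall>e\<in>S. 0 \<le> ?c \<and> ?c \<le> 1"
      using that by (auto simp: divide_simps)
    show "(\<Sum>e\<in>S. ?c *\<^sub>R v e) = 0"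
      using sum0 by (simp only: scaleR_sum_right[symmetric]) simp
  qed
  then have "\<exists>es. distinct es \<and> set es = S \<and>
    (\<forall>m k. \<bar>(\<Sum>e\<in>set (take m es). v e) $ k\<bar> \<le> real CARD('r) * M)"
    using assms by (intro steinitz_ordering_weighted) auto
  with that show thesis
    by metis
qed

section \<open>Zero-sum-free families of integer vectors\<close>

lemma real_vec_nth [simp]: "real_vec u $ j = real_of_int (u $ j)"
  by (simp add: real_vec_def)

lemma real_vec_0 [simp]: "real_vec 0 = 0"
  by (simp add: vec_eq_iff)

lemma real_vec_add: "real_vec (u + v) = real_vec u + real_vec v"
  by (simp add: vec_eq_iff)

lemma real_vec_diff: "real_vec (u - v) = real_vec u - real_vec v"
  by (simp add: vec_eq_iff)

lemma real_vec_sum: "real_vec (sum f S) = (\<Sum>a\<in>S. real_vec (f a))"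
  by (simp add: vec_eq_iff)

lemma real_vec_eq_iff [simp]: "real_vec u = real_vec v \<longleftrightarrow> u = v"
  by (simp add: vec_eq_iff)

lemma int_box:
  fixes N :: nat
  shows finite_int_box: "finite {u :: int ^ 'r::finite. \<forall>k. \<bar>u $ k\<bar> \<le> int N}" (is "finite ?B")
    and card_int_box: "card {u :: int ^ 'r::finite. \<forall>k. \<bar>u $ k\<bar> \<le> int N} \<le> (2 * N + 1) ^ CARD('r)"
proof -
  let ?P = "PiE (UNIV :: 'r set) (\<lambda>_. {- int N..int N})"
  have sub: "vec_nth ` ?B \<subseteq> ?P" by (auto simp: abs_le_iff) (metis minus_le_iff)
  have inj: "inj_on vec_nth ?B" by (auto intro!: inj_onI simp: vec_eq_iff)
  have fin: "finite ?P" by (intro finite_PiE) auto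
  show "finite ?B" using sub inj fin by (meson finite_imageD finite_subset)
  have "card ?B = card (vec_nth ` ?B)" using inj by (simp add: card_image)
  also have "\<dots> \<le> card ?P" using sub fin by (intro card_mono)
  also have "\<dots> = (2 * N + 1) ^ CARD('r)"
    by (simp add: card_PiE nat_add_distrib nat_mult_distrib)
  finally show "card ?B \<le> (2 * N + 1) ^ CARD('r)" .
qed

text \<open>Greedy: each index takes as much of \<open>s\<close> as the interval from
  \<open>- m\<close> to \<open>m\<close> admits. Used in each coordinate to spread the negated total
  over the appended vectors.\<close>

lemma split_int_bounded:
  fixes s :: int
  assumes "finite S" "\<bar>s\<bar> \<le> int (card S) * m" "m \<ge> 0"
  shows "\<exists>f. (\<forall>l\<in>S. \<bar>f l\<bar> \<le> m) \<and> sum f S = s"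
  using assms(1,2)
proof (induction S arbitrary: s)
  case empty
  then show ?case by simp
next
  case (insert a S)
  define t where "t = max (- m) (min m s)"
  have "\<bar>s - t\<bar> \<le> int (card S) * m"
    using insert \<open>m \<ge> 0\<close> by (auto simp: t_def algebra_simps max_def min_def abs_if split: if_splits)
  then obtain f where f: "\<forall>l\<in>S. \<bar>f l\<bar> \<le> m" "sum f S = s - t" using insert.IH by blast
  have "sum (f(a := t)) S = sum f S"
    using insert.hyps by (intro sum.cong) auto
  then have "sum (f(a := t)) (insert a S) = s"
    using insert.hyps f(2) by simp
  moreover have "\<bar>t\<bar> \<le> m" using \<open>m \<ge> 0\<close> by (auto simp: t_def)
  ultimately show ?case using f(1) by (intro exI[of _ "f(a := t)"]) auto
qed

text \<open>The family is completed to one of sum zero by \<open>CARD('r)\<close> further vectors of the same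
  size. In a Steinitz ordering, two prefixes with the same sum and the same number of additional
  vectors differ by a zero-sum subfamily.\<close>

lemma zero_sum_free_card_le:
  fixes V :: "'e \<Rightarrow> int ^ 'r::finite" and M :: nat
  assumes fin: "finite E"
    and bound: "\<And>e k. e \<in> E \<Longrightarrow> \<bar>V e $ k\<bar> \<le> int M"
    and total: "\<And>k. \<bar>(\<Sum>e\<in>E. V e) $ k\<bar> \<le> int (CARD('r) * M)"
    and free: "\<And>I. I \<subseteq> E \<Longrightarrow> I \<noteq> {} \<Longrightarrow> (\<Sum>e\<in>I. V e) \<noteq> 0"
  shows "card E + CARD('r) + 1 \<le> (CARD('r) + 1) * (2 * (CARD('r) * M) + 1) ^ CARD('r)"
proof -
  have "\<exists>f. (\<forall>l\<in>(UNIV::'r set). \<bar>f l\<bar> \<le> int M) \<and> sum f UNIV = - (\<Sum>e\<in>E. V e) $ k" for k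
    using total[of k] by (intro split_int_bounded) auto
  then obtain f :: "'r \<Rightarrow> 'r \<Rightarrow> int"
    where f: "\<And>k l. \<bar>f k l\<bar> \<le> int M" "\<And>k. sum (f k) UNIV = - (\<Sum>e\<in>E. V e) $ k"
    by (metis UNIV_I)
  define v where "v = case_sum V (\<lambda>l. \<chi> k. f k l)"
  define S where "S = Inl ` E \<union> range (Inr :: 'r \<Rightarrow> 'e + 'r)"
  have finS: "finite S" using fin by (simp add: S_def)
  have sumS: "sum v S = 0"
  proof -
    have "sum v S = sum v (Inl ` E) + sum v (range Inr)"
      unfolding S_def using fin by (intro sum.union_disjoint) auto
    also have "\<dots> = (\<Sum>e\<in>E. V e) + (\<Sum>l\<in>UNIV. \<chi> k. f k l)"
      by (simp add: sum.reindex v_def)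
    also have "\<dots> = 0"
      using f(2) by (simp add: vec_eq_iff)
    finally show ?thesis .
  qed
  have "\<bar>real_vec (v e) $ k\<bar> \<le> real M" if "e \<in> S" for e k
  proof -
    have "\<bar>v e $ k\<bar> \<le> int M" using that bound f(1) by (auto simp: S_def v_def)
    then show ?thesis by (simp flip: of_int_abs) 
  qed
  moreover have "(\<Sum>e\<in>S. real_vec (v e)) = 0"
    using sumS by (simp flip: real_vec_sum)
  ultimately obtain es where es: "distinct es" "set es = S"
    and "\<And>m k. \<bar>(\<Sum>e\<in>set (take m es). real_vec (v e)) $ k\<bar> \<le> real CARD('r) * real M"
    by (rule steinitz_ordering[OF finS, of "\<lambda>e. real_vec (v e)" "real M"]) auto
  then have pre: "\<bar>(\<Sum>e\<in>set (take m es). v e) $ k\<bar> \<le> int (CARD('r) * M)" for m k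
  proof -
    have "real_of_int \<bar>(\<Sum>e\<in>set (take m es). v e) $ k\<bar> \<le> real_of_int (int (CARD('r) * M))"
      using \<open>\<And>m k. \<bar>(\<Sum>e\<in>set (take m es). real_vec (v e)) $ k\<bar> \<le> real CARD('r) * real M\<close>[of m k]
      by simp
    then show ?thesis by (simp only: of_int_le_iff)
  qed
  have len: "length es = card E + CARD('r)"
  proof -
    have "length es = card S" using es distinct_card by metis
    also have "\<dots> = card (Inl ` E :: ('e + 'r) set) + card (range (Inr :: 'r \<Rightarrow> 'e + 'r))"
      unfolding S_def using fin by (intro card_Un_disjoint) auto
    also have "\<dots> = card E + CARD('r)" by (simp add: card_image)
    finally show ?thesis .
  qed
  \<comment> \<open>Prefixes are nested, so equal counts mean that the same appended vectors occur;
    the difference then consists of members of the family only.\<close>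
  define c where "c i = card (set (take i es) \<inter> range (Inr :: 'r \<Rightarrow> 'e + 'r))" for i
  define P where "P i = (\<Sum>e\<in>set (take i es). v e)" for i
  let ?B = "{u :: int ^ 'r. \<forall>k. \<bar>u $ k\<bar> \<le> int (CARD('r) * M)}"
  have noteq: "(c i, P i) \<noteq> (c j, P j)" if ij: "i < j" "j \<le> length es" for i j
  proof
    assume eq: "(c i, P i) = (c j, P j)"
    define D where "D = set (take j es) - set (take i es)"
    have sub: "set (take i es) \<subseteq> set (take j es)"
      using ij by (intro set_take_subset_set_take) simp
    have "card (set (take i es)) < card (set (take j es))"
      using es(1) ij by (simp add: distinct_card)
    then have D: "D \<noteq> {}" unfolding D_def using sub by (metis Diff_eq_empty_iff subset_antisym less_irrefl)
    have "set (take i es) \<inter> range Inr = set (take j es) \<inter> range (Inr :: 'r \<Rightarrow> 'e + 'r)"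
      using eq sub unfolding c_def by (intro card_subset_eq) auto
    then have "D \<inter> range Inr = {}" by (auto simp: D_def)
    moreover have "D \<subseteq> S" using es(2) set_take_subset[of j es] by (auto simp: D_def)
    ultimately have DE: "D \<subseteq> Inl ` E" by (auto simp: S_def)
    then obtain I where I: "I \<subseteq> E" "D = Inl ` I" by (meson subset_imageE)
    have "(\<Sum>e\<in>I. V e) = sum v D"
      by (simp add: I sum.reindex v_def)
    also have "\<dots> = P j - P i"
      unfolding P_def D_def using sub by (intro sum_diff) auto
    also have "\<dots> = 0" using eq by simp
    finally show False using free[OF I(1)] I D by auto
  qed
  \<comment> \<open>The empty prefix counts too: there are \<open>length es + 1\<close> of them,
    whence the \<open>+ 1\<close> in the bound.\<close>
  have "inj_on (\<lambda>i. (c i, P i)) {..length es}"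
    by (intro linorder_inj_onI) (use noteq in auto)
  then have "card {..length es} = card ((\<lambda>i. (c i, P i)) ` {..length es})"
    by (simp only: card_image)
  also have "\<dots> \<le> card ({..CARD('r)} \<times> ?B)"
  proof (intro card_mono)
    show "finite ({..CARD('r)} \<times> ?B)" by (intro finite_SigmaI finite_int_box) auto
    have "c i \<le> CARD('r)" for i
      unfolding c_def using card_mono[of "range (Inr :: 'r \<Rightarrow> 'e + 'r)" "set (take i es) \<inter> range Inr"]
      by (simp add: card_image)
    then show "(\<lambda>i. (c i, P i)) ` {..length es} \<subseteq> {..CARD('r)} \<times> ?B"
      using pre by (auto simp: P_def)
  qed
  also have "\<dots> \<le> (CARD('r) + 1) * (2 * (CARD('r) * M) + 1) ^ CARD('r)"
    using card_int_box[where 'r = 'r, of "CARD('r) * M"] by (simp add: card_cartesian_product del: mult_Suc)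
  finally show ?thesis using len by simp
qed

section \<open>Sign-compatible decompositions\<close>

text \<open>The sign-compatible partial order: \<open>v\<close> has the signs of \<open>u\<close>
  and is bounded by it in absolute value. Where \<open>u $ j = 0\<close> both implications apply and
  force \<open>v $ j = 0\<close>.\<close>

definition conforms :: "int ^ 't::finite \<Rightarrow> int ^ 't \<Rightarrow> bool" where
  "conforms v u \<longleftrightarrow>
     (\<forall>j. (0 \<le> u $ j \<longrightarrow> 0 \<le> v $ j \<and> v $ j \<le> u $ j) \<and> (u $ j \<le> 0 \<longrightarrow> u $ j \<le> v $ j \<and> v $ j \<le> 0))"

lemma l1_norm_nonneg [simp]: "0 \<le> l1_norm (x :: 'a::linordered_idom ^ 't::finite)"
  by (simp add: l1_norm_def sum_nonneg)

lemma l1_norm_eq_0_iff [simp]: "l1_norm (x :: 'a::linordered_idom ^ 't::finite) = 0 \<longleftrightarrow> x = 0"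
  by (simp add: l1_norm_def sum_nonneg_eq_0_iff vec_eq_iff)

lemma l1_norm_0 [simp]: "l1_norm (0 :: 'a::linordered_idom ^ 't::finite) = 0"
  by simp

lemma l1_norm_triangle:
  "l1_norm (x + y :: 'a::linordered_idom ^ 't::finite) \<le> l1_norm x + l1_norm y"
  by (simp add: l1_norm_def sum_mono abs_triangle_ineq flip: sum.distrib)

lemma l1_norm_sum:
  "l1_norm (\<Sum>a\<in>S. f a :: 'a::linordered_idom ^ 't::finite) \<le> (\<Sum>a\<in>S. l1_norm (f a))"
proof (induction S rule: infinite_finite_induct)
  case (insert a S)
  then show ?case using l1_norm_triangle[of "f a" "sum f S"] by simp
qed auto

lemma l1_norm_minus [simp]: "l1_norm (- x :: 'a::linordered_idom ^ 't::finite) = l1_norm x"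
  by (simp add: l1_norm_def)

lemma l1_norm_scaleR: "l1_norm (c *\<^sub>R x) = \<bar>c\<bar> * l1_norm (x :: real ^ 't::finite)"
  by (simp add: l1_norm_def abs_mult sum_distrib_left)

lemma l1_norm_real_vec [simp]: "l1_norm (real_vec u) = real_of_int (l1_norm u)"
  by (simp add: l1_norm_def)

lemma int_kernel_add:
  "u \<in> int_kernel J K C \<Longrightarrow> v \<in> int_kernel J K C \<Longrightarrow> u + v \<in> int_kernel J K C"
  by (simp add: int_kernel_def vecs_on_def matrix_vector_right_distrib)

lemma int_kernel_sum:
  "(\<And>a. a \<in> S \<Longrightarrow> f a \<in> int_kernel J K C) \<Longrightarrow> sum f S \<in> int_kernel J K C"
proof (induction S rule: infinite_finite_induct)
  case (insert a S)
  then show ?case by (simp add: int_kernel_add)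
qed (auto simp: int_kernel_def vecs_on_def)

lemma graver_basis_subset: "graver_basis J K C \<subseteq> int_kernel J K C"
  by (auto simp: graver_basis_def)

text \<open>A nonzero kernel vector outside the Graver basis splits sign-compatibly into two nonzero
  kernel vectors. Without cancellation the norms add up, so both parts have smaller norm.\<close>

lemma graver_decomposition_list:
  assumes "u \<in> int_kernel J K C"
  shows "\<exists>gs. set gs \<subseteq> graver_basis J K C \<and> sum_list gs = u \<and>
    (\<forall>g\<in>set gs. \<forall>j. (0 \<le> u $ j \<longrightarrow> 0 \<le> g $ j) \<and> (u $ j \<le> 0 \<longrightarrow> g $ j \<le> 0))"
  using assms
proof (induction "nat (l1_norm u)" arbitrary: u rule: less_induct)
  case less
  consider "u = 0" | "u \<in> graver_basis J K C" | "u \<noteq> 0" "u \<notin> graver_basis J K C" by blast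
  then show ?case
  proof cases
    case 1
    then show ?thesis by (intro exI[of _ "[]"]) auto
  next
    case 2
    then show ?thesis by (intro exI[of _ "[u]"]) auto
  next
    case 3
    then obtain v w where vw: "v \<in> int_kernel J K C" "w \<in> int_kernel J K C" "v \<noteq> 0" "w \<noteq> 0"
      "\<forall>j. 0 \<le> v $ j * w $ j" "u = v + w"
      using less.prems by (auto simp: graver_basis_def)
    have "\<bar>v $ j + w $ j\<bar> = \<bar>v $ j\<bar> + \<bar>w $ j\<bar>" for j
      using vw(5)[rule_format, of j] by (auto simp: zero_le_mult_iff)
    then have l1: "l1_norm u = l1_norm v + l1_norm w"
      by (simp add: l1_norm_def vw(6) sum.distrib)
    moreover have "l1_norm v > 0" "l1_norm w > 0"
      using vw(3,4) by (simp_all add: order_less_le)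
    ultimately have "nat (l1_norm v) < nat (l1_norm u)" "nat (l1_norm w) < nat (l1_norm u)"
      by auto
    from less.hyps[OF this(1) vw(1)] less.hyps[OF this(2) vw(2)]
    obtain gs hs where gs: "set gs \<subseteq> graver_basis J K C" "sum_list gs = v"
      "\<forall>g\<in>set gs. \<forall>j. (0 \<le> v $ j \<longrightarrow> 0 \<le> g $ j) \<and> (v $ j \<le> 0 \<longrightarrow> g $ j \<le> 0)"
      and hs: "set hs \<subseteq> graver_basis J K C" "sum_list hs = w"
      "\<forall>g\<in>set hs. \<forall>j. (0 \<le> w $ j \<longrightarrow> 0 \<le> g $ j) \<and> (w $ j \<le> 0 \<longrightarrow> g $ j \<le> 0)"
      by blast
    have sgn: "(0 \<le> u $ j \<longrightarrow> 0 \<le> v $ j \<and> 0 \<le> w $ j) \<and> (u $ j \<le> 0 \<longrightarrow> v $ j \<le> 0 \<and> w $ j \<le> 0)" for j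
      using vw(5)[rule_format, of j] by (auto simp: zero_le_mult_iff vw(6))
    show ?thesis
    proof (intro exI[of _ "gs @ hs"] conjI)
      show "\<forall>g\<in>set (gs @ hs). \<forall>j. (0 \<le> u $ j \<longrightarrow> 0 \<le> g $ j) \<and> (u $ j \<le> 0 \<longrightarrow> g $ j \<le> 0)"
        using gs(3) hs(3) sgn by (metis Un_iff set_append)
    qed (use gs hs vw(6) in auto)
  qed
qed

text \<open>Elements may repeat, hence the indexing by \<open>{..<n}\<close>. Conformity of every
  partial sum is what later permits exchanging arbitrary subfamilies.\<close>

lemma graver_decomposition:
  assumes "u \<in> int_kernel J K C"
  obtains n :: nat and g where "\<And>k. k < n \<Longrightarrow> g k \<in> graver_basis J K C" "u = (\<Sum>k<n. g k)"
    "\<And>I. I \<subseteq> {..<n} \<Longrightarrow> conforms (\<Sum>k\<in>I. g k) u"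
proof -
  obtain gs where gs: "set gs \<subseteq> graver_basis J K C" "sum_list gs = u"
    and sgn: "\<forall>g\<in>set gs. \<forall>j. (0 \<le> u $ j \<longrightarrow> 0 \<le> g $ j) \<and> (u $ j \<le> 0 \<longrightarrow> g $ j \<le> 0)"
    using graver_decomposition_list[OF assms] by blast
  have u: "u = (\<Sum>k<length gs. gs ! k)"
    using gs(2) by (simp add: sum_list_sum_nth atLeast0LessThan)
  show thesis
  proof (rule that)
    show "gs ! k \<in> graver_basis J K C" if "k < length gs" for k
      using gs(1) that by auto
    show "u = (\<Sum>k<length gs. gs ! k)" by (rule u)
    fix I assume I: "I \<subseteq> {..<length gs}"
    show "conforms (\<Sum>k\<in>I. gs ! k) u"
      unfolding conforms_def
    proof (intro allI conjI impI)
      fix j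
      have uj: "u $ j = (\<Sum>k<length gs. gs ! k $ j)" by (subst u) simp
      { assume "0 \<le> u $ j"
        then have nn: "0 \<le> gs ! k $ j" if "k < length gs" for k using sgn that by simp
        show "0 \<le> (\<Sum>k\<in>I. gs ! k) $ j"
          using I nn by (auto intro!: sum_nonneg)
        show "(\<Sum>k\<in>I. gs ! k) $ j \<le> u $ j"
          unfolding uj sum_component using I nn by (intro sum_mono2) auto }
      { assume "u $ j \<le> 0"
        then have nn: "gs ! k $ j \<le> 0" if "k < length gs" for k using sgn that by simp
        show "(\<Sum>k\<in>I. gs ! k) $ j \<le> 0"
          using I nn by (auto intro!: sum_nonpos)
        have "(\<Sum>k\<in>I. - (gs ! k $ j)) \<le> (\<Sum>k<length gs. - (gs ! k $ j))"
          using I nn by (intro sum_mono2) auto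
        then show "u $ j \<le> (\<Sum>k\<in>I. gs ! k) $ j"
          by (simp add: uj sum_negf) }
    qed
  qed
qed

lemma l1_norm_conforms_diff: "conforms v u \<Longrightarrow> l1_norm (u - v) = l1_norm u - l1_norm v"
proof -
  assume v: "conforms v u"
  have "\<bar>(u - v) $ j\<bar> = \<bar>u $ j\<bar> - \<bar>v $ j\<bar>" for j
    using v[unfolded conforms_def, rule_format, of j] by (cases "0 \<le> u $ j") auto
  then show ?thesis by (simp add: l1_norm_def sum_subtractf)
qed

section \<open>Lattice points of a single block\<close>

definition int_points :: "'t set \<Rightarrow> 'm set \<Rightarrow> int ^ 't ^ 'm \<Rightarrow> int ^ 'm \<Rightarrow> (int ^ 't::finite) set" where
  "int_points J K C d =
     {u \<in> vecs_on J. (\<forall>k\<in>K. (C *v u) $ k = d $ k) \<and> (\<forall>j. 0 \<le> u $ j)}"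

lemma integer_hull_eq: "integer_hull J K C d = convex hull (real_vec ` int_points J K C d)"
  by (simp add: integer_hull_def int_points_def)

lemma int_points_diff:
  "p \<in> int_points J K C d \<Longrightarrow> q \<in> int_points J K C d \<Longrightarrow> p - q \<in> int_kernel J K C"
  by (simp add: int_points_def int_kernel_def vecs_on_def matrix_vector_mult_diff_distrib)

text \<open>Subtracting a part of \<open>p - q\<close> from \<open>p\<close> stays between \<open>p\<close> and \<open>q\<close>.\<close>

lemma int_points_exchange:
  assumes "p \<in> int_points J K C d" "q \<in> int_points J K C d" "g \<in> int_kernel J K C" "conforms g (p - q)"
  shows "p - g \<in> int_points J K C d" "q + g \<in> int_points J K C d"
    "(p - g) $ j \<le> max (p $ j) (q $ j)" "(q + g) $ j \<le> max (p $ j) (q $ j)"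
proof -
  have g: "(q $ j \<le> p $ j \<longrightarrow> 0 \<le> g $ j \<and> g $ j \<le> p $ j - q $ j) \<and>
      (p $ j \<le> q $ j \<longrightarrow> p $ j - q $ j \<le> g $ j \<and> g $ j \<le> 0)" for j
    using assms(4) by (auto simp: conforms_def)
  have nn: "0 \<le> p $ j" "0 \<le> q $ j" for j using assms by (auto simp: int_points_def)
  have nn2: "0 \<le> p $ j - g $ j" "0 \<le> q $ j + g $ j" for j
    using g[of j] nn[of j] by linarith+
  show "p - g \<in> int_points J K C d" "q + g \<in> int_points J K C d"
    using assms(1-3) nn2
    by (simp_all add: int_points_def int_kernel_def vecs_on_def
        matrix_vector_mult_diff_distrib matrix_vector_right_distrib)
  show "(p - g) $ j \<le> max (p $ j) (q $ j)" "(q + g) $ j \<le> max (p $ j) (q $ j)"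
    using g[of j] by (auto simp: max_def)
qed

text \<open>The polyhedron \<open>?H\<close> of the relaxed system is convex and contains the
  generating points, hence the hull; its integral elements are again such points.\<close>

lemma integral_in_integer_hull:
  fixes J :: "'t::finite set"
  assumes "x \<in> integer_hull J K C d" "integral_vec x"
  obtains u where "u \<in> int_points J K C d" "x = real_vec u"
proof -
  let ?H = "{x :: real ^ 't. (\<forall>j. j \<notin> J \<longrightarrow> x $ j = 0) \<and>
    (\<forall>k\<in>K. (real_mat C *v x) $ k = real_of_int (d $ k)) \<and> (\<forall>j. 0 \<le> x $ j)}"
  have mat: "(real_mat C *v real_vec u) $ k = real_of_int ((C *v u) $ k)" for u k
    by (simp add: real_mat_def matrix_vector_mult_def)
  have "convex ?H"
  proof (rule convexI)
    fix x y and a b :: real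
    assume xy: "x \<in> ?H" "y \<in> ?H" and ab: "0 \<le> a" "0 \<le> b" "a + b = 1"
    have "(real_mat C *v (a *\<^sub>R x + b *\<^sub>R y)) $ k = real_of_int (d $ k)" if "k \<in> K" for k
    proof -
      have "(real_mat C *v (a *\<^sub>R x + b *\<^sub>R y)) $ k = (a + b) * real_of_int (d $ k)"
        using xy that by (simp add: matrix_vector_right_distrib matrix_vector_mult_scaleR algebra_simps)
      then show ?thesis using ab by simp
    qed
    moreover have "\<forall>j. j \<notin> J \<longrightarrow> (a *\<^sub>R x + b *\<^sub>R y) $ j = 0" using xy by simp
    moreover have "\<forall>j. 0 \<le> (a *\<^sub>R x + b *\<^sub>R y) $ j" using xy ab by simp
    ultimately show "a *\<^sub>R x + b *\<^sub>R y \<in> ?H" by blast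
  qed
  moreover have "real_vec ` int_points J K C d \<subseteq> ?H"
    by (auto simp: mat int_points_def vecs_on_def)
  ultimately have "integer_hull J K C d \<subseteq> ?H"
    unfolding integer_hull_eq by (intro hull_minimal)
  then have x: "x \<in> ?H"
    using assms(1) by (rule subsetD)
  define u where "u = (\<chi> j. \<lfloor>x $ j\<rfloor>)"
  have xu: "x = real_vec u"
    using assms(2) by (simp add: vec_eq_iff u_def integral_vec_def)
  have "u \<in> int_points J K C d"
    using x unfolding xu by (simp add: mat int_points_def vecs_on_def)
  then show thesis using that xu by blast
qed

lemma real_vec_in_integer_hull: "u \<in> int_points J K C d \<Longrightarrow> real_vec u \<in> integer_hull J K C d"
  unfolding integer_hull_eq by (rule hull_inc) auto

lemma integral_real_vec [simp]: "integral_vec (real_vec u)"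
  by (simp add: integral_vec_def)

lemma convex_integer_hull: "convex (integer_hull J K C d)"
  by (simp add: integer_hull_def)

section \<open>Faces and convex combinations of lattice points\<close>

text \<open>A point lies in the relative interior of its minimal face, since otherwise a supporting
  hyperplane would cut out a smaller face containing it. Segments of the face ending there can
  therefore be prolonged.\<close>

lemma minimal_face_prolong:
  fixes Q :: "'a::euclidean_space set"
  assumes "convex Q" "minimal_face Q x F" "y \<in> F"
  obtains \<epsilon> where "\<epsilon> > 0" "x + \<epsilon> *\<^sub>R (x - y) \<in> Q"
proof -
  have F: "F face_of Q" "x \<in> F" and least: "\<And>F'. F' face_of Q \<Longrightarrow> x \<in> F' \<Longrightarrow> F \<subseteq> F'"
    using assms(2) by (auto simp: minimal_face_def)
  have cF: "convex F" using F(1) by (rule face_of_imp_convex)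
  have ne: "F \<noteq> {}" using F(2) by blast
  have "x \<in> rel_interior F"
  proof (rule ccontr)
    assume "x \<notin> rel_interior F"
    then obtain a where a: "\<And>y. y \<in> F \<Longrightarrow> a \<bullet> x \<le> a \<bullet> y" "\<And>y. y \<in> rel_interior F \<Longrightarrow> a \<bullet> x < a \<bullet> y"
      using supporting_hyperplane_rel_boundary[OF cF F(2)] by metis
    have "(F \<inter> {w. a \<bullet> w = a \<bullet> x}) face_of F"
      using cF a(1) by (rule face_of_Int_supporting_hyperplane_ge)
    then have "F \<subseteq> F \<inter> {w. a \<bullet> w = a \<bullet> x}"
      using least face_of_trans[OF _ F(1)] F(2) by blast
    moreover obtain w where "w \<in> rel_interior F"
      using rel_interior_eq_empty[OF cF] ne by blast
    moreover have "rel_interior F \<subseteq> F" by (rule rel_interior_subset)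
    ultimately show False using a(2)[of w] by auto
  qed
  then obtain e where e: "e > 1" "(1 - e) *\<^sub>R y + e *\<^sub>R x \<in> F"
    using convex_rel_interior_iff[OF cF ne] assms(3) by blast
  show thesis
  proof (rule that)
    show "e - 1 > 0" using e by simp
    have "x + (e - 1) *\<^sub>R (x - y) = (1 - e) *\<^sub>R y + e *\<^sub>R x" by (simp add: algebra_simps)
    then show "x + (e - 1) *\<^sub>R (x - y) \<in> Q" using e(2) F(1) face_of_imp_subset by auto
  qed
qed

lemma convex_step:
  assumes "convex Q" "x \<in> Q" "x + \<epsilon> *\<^sub>R u \<in> Q" "0 \<le> \<delta>" "\<delta> \<le> \<epsilon>"
  shows "x + \<delta> *\<^sub>R u \<in> Q"
proof (cases "\<epsilon> = 0")
  case False
  then have "\<epsilon> > 0" using assms by linarith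
  have "(1 - \<delta> / \<epsilon>) *\<^sub>R x + (\<delta> / \<epsilon>) *\<^sub>R (x + \<epsilon> *\<^sub>R u) \<in> Q"
    using assms \<open>\<epsilon> > 0\<close> by (intro convexD) auto
  also have "(1 - \<delta> / \<epsilon>) *\<^sub>R x + (\<delta> / \<epsilon>) *\<^sub>R (x + \<epsilon> *\<^sub>R u) = x + \<delta> *\<^sub>R u"
    using \<open>\<epsilon> > 0\<close> by (simp add: algebra_simps)
  finally show ?thesis .
qed (use assms in auto)

text \<open>Mixing the prolonged point \<open>x + \<epsilon> *\<^sub>R (x - y)\<close> with
  \<open>y + u\<close> in the ratio 1 to \<open>\<epsilon>\<close> cancels \<open>y\<close> and
  leaves a multiple of \<open>u\<close> added to \<open>x\<close>.\<close>

lemma minimal_face_feasible_direction: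
  fixes Q :: "'a::euclidean_space set"
  assumes "convex Q" "minimal_face Q x F" "y \<in> F" "y + u \<in> Q"
  shows "\<exists>\<epsilon>>0. x + \<epsilon> *\<^sub>R u \<in> Q"
proof -
  obtain \<epsilon> where e: "\<epsilon> > 0" "x + \<epsilon> *\<^sub>R (x - y) \<in> Q"
    using minimal_face_prolong[OF assms(1-3)] .
  have "(1 / (1 + \<epsilon>)) *\<^sub>R (x + \<epsilon> *\<^sub>R (x - y)) + (\<epsilon> / (1 + \<epsilon>)) *\<^sub>R (y + u) \<in> Q"
    using assms e by (intro convexD) (auto simp: divide_simps)
  also have "(1 / (1 + \<epsilon>)) *\<^sub>R (x + \<epsilon> *\<^sub>R (x - y)) + (\<epsilon> / (1 + \<epsilon>)) *\<^sub>R (y + u)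
      = (1 / (1 + \<epsilon>)) *\<^sub>R ((1 + \<epsilon>) *\<^sub>R x + \<epsilon> *\<^sub>R u)"
    by (simp add: algebra_simps)
  also have "\<dots> = x + (\<epsilon> / (1 + \<epsilon>)) *\<^sub>R u"
    using e by (simp add: scaleR_add_right)
  finally show ?thesis using e by (intro exI[of _ "\<epsilon> / (1 + \<epsilon>)"]) auto
qed

text \<open>Weight \<open>\<delta>\<close> is shifted from \<open>f p\<close> to \<open>c\<close>
  and from \<open>f q\<close> to \<open>c'\<close>. The new points need not belong to the family:
  instead of changing weights, \<open>h\<close> moves the points \<open>f p\<close> and
  \<open>f q\<close> inside \<open>C\<close>.\<close>

lemma convex_sum_exchange:
  fixes f :: "'e \<Rightarrow> 'a::real_vector"
  assumes "convex C" "finite P" "\<And>a. a \<in> P \<Longrightarrow> f a \<in> C" "\<And>a. a \<in> P \<Longrightarrow> 0 \<le> \<mu> a" "sum \<mu> P = 1"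
    and pq: "p \<in> P" "q \<in> P" "p \<noteq> q" and c: "c \<in> C" "c' \<in> C"
    and \<delta>: "0 < \<delta>" "\<delta> \<le> \<mu> p" "\<delta> \<le> \<mu> q"
  shows "(\<Sum>a\<in>P. \<mu> a *\<^sub>R f a) + \<delta> *\<^sub>R (c - f p) + \<delta> *\<^sub>R (c' - f q) \<in> C"
proof -
  define h where "h a = f a + (if a = p then (\<delta> / \<mu> p) *\<^sub>R (c - f p) else 0)
    + (if a = q then (\<delta> / \<mu> q) *\<^sub>R (c' - f q) else 0)" for a
  have step: "f a + (\<delta> / \<mu> a) *\<^sub>R (b - f a) \<in> C" if "a \<in> P" "b \<in> C" "\<delta> \<le> \<mu> a" for a b
  proof (rule convex_step[OF assms(1), where \<epsilon> = 1])
    show "f a \<in> C" "f a + 1 *\<^sub>R (b - f a) \<in> C" using that assms(3) by simp_all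
    show "0 \<le> \<delta> / \<mu> a" "\<delta> / \<mu> a \<le> 1" using that(3) \<delta>(1) by simp_all
  qed
  have "h a \<in> C" if "a \<in> P" for a
    using that step[OF pq(1) c(1) \<delta>(2)] step[OF pq(2) c(2) \<delta>(3)] assms(3) pq(3) by (simp add: h_def)
  then have "(\<Sum>a\<in>P. \<mu> a *\<^sub>R h a) \<in> C"
    by (intro convex_sum assms(1,2,4,5))
  moreover have "(\<Sum>a\<in>P. \<mu> a *\<^sub>R h a) = (\<Sum>a\<in>P. \<mu> a *\<^sub>R f a
      + (if a = p then \<delta> *\<^sub>R (c - f p) else 0) + (if a = q then \<delta> *\<^sub>R (c' - f q) else 0))"
    using \<delta> by (intro sum.cong) (auto simp: h_def scaleR_add_right)
  moreover have "\<dots> = (\<Sum>a\<in>P. \<mu> a *\<^sub>R f a) + \<delta> *\<^sub>R (c - f p) + \<delta> *\<^sub>R (c' - f q)"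
    by (simp add: sum.distrib sum.delta[OF assms(2)] pq(1,2))
  ultimately show ?thesis by simp
qed

text \<open>Among the convex combinations of lattice points in a large box, one with least
  \<open>\<Sum>\<^sub>p \<mu>\<^sub>p |p|\<^sup>2\<close> is taken; it is found on the lower boundary of the hull of the points \<open>(p, |p|\<^sup>2)\<close>.\<close>

lemma minimal_convex_combination:
  fixes x :: "real ^ 't::finite"
  assumes x: "x \<in> integer_hull J K C d"
  obtains P \<mu> where "finite P" "P \<subseteq> int_points J K C d"
    "\<forall>p\<in>P. \<forall>q\<in>P. \<forall>g\<in>int_kernel J K C. conforms g (p - q) \<longrightarrow> p - g \<in> P \<and> q + g \<in> P"
    "\<forall>p\<in>P. 0 \<le> \<mu> p" "sum \<mu> P = (1::real)" "x = (\<Sum>p\<in>P. \<mu> p *\<^sub>R real_vec p)"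
    "\<forall>p\<in>P. \<forall>q\<in>P. \<forall>a\<in>P. \<forall>b\<in>P. p \<noteq> q \<and> 0 < \<mu> p \<and> 0 < \<mu> q \<and> a + b = p + q \<longrightarrow>
       real_vec p \<bullet> real_vec p + real_vec q \<bullet> real_vec q \<le> real_vec a \<bullet> real_vec a + real_vec b \<bullet> real_vec b"
proof -
  let ?S = "int_points J K C d"
  obtain X u0 where X: "finite X" "X \<subseteq> real_vec ` ?S" and u0: "\<forall>v\<in>X. 0 \<le> u0 v" "sum u0 X = 1"
    "(\<Sum>v\<in>X. u0 v *\<^sub>R v) = x"
    using x unfolding integer_hull_eq convex_hull_explicit by auto
  have "x \<in> convex hull X" unfolding convex_hull_finite[OF X(1)] using u0 by blast
  then obtain T where T: "finite T" "T \<subseteq> ?S" "x \<in> convex hull (real_vec ` T)"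
    using finite_subset_image[OF X] by blast
  \<comment> \<open>Unlike \<open>T\<close>, all lattice points of the box are closed under
    conforming exchanges, which never exceed the larger of the two coordinates.\<close>
  define N where "N = nat (\<Sum>p\<in>T. l1_norm p)"
  define P where "P = {p \<in> ?S. \<forall>j. p $ j \<le> int N}"
  have "P \<subseteq> {u. \<forall>k. \<bar>u $ k\<bar> \<le> int N}" by (auto simp: P_def int_points_def)
  then have finP: "finite P" using finite_int_box finite_subset by blast
  have TP: "T \<subseteq> P"
  proof
    fix p assume p: "p \<in> T"
    have "p $ j \<le> int N" for j
    proof -
      have "p $ j \<le> \<bar>p $ j\<bar>" by simp
      also have "\<dots> \<le> l1_norm p" unfolding l1_norm_def by (intro member_le_sum) auto
      also have "\<dots> \<le> (\<Sum>p\<in>T. l1_norm p)" using p T(1) by (intro member_le_sum) auto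
      finally show ?thesis by (simp add: N_def sum_nonneg)
    qed
    then show "p \<in> P" using p T(2) by (auto simp: P_def)
  qed
  have exch: "p - g \<in> P \<and> q + g \<in> P"
    if "p \<in> P" "q \<in> P" "g \<in> int_kernel J K C" "conforms g (p - q)" for p q g
  proof -
    have p: "p \<in> ?S" "q \<in> ?S" "\<And>j. max (p $ j) (q $ j) \<le> int N" using that(1,2) by (simp_all add: P_def)
    note ex = int_points_exchange[OF p(1,2) that(3,4)]
    show ?thesis
      using ex(1,2) order_trans[OF ex(3) p(3)] order_trans[OF ex(4) p(3)] by (simp add: P_def)
  qed
  define lift where "lift p = (real_vec p, real_vec p \<bullet> real_vec p)" for p :: "int ^ 't"
  have inj: "inj_on lift P" by (auto simp: lift_def inj_on_def)
  let ?H = "convex hull (lift ` P)"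
  have "x \<in> fst ` ?H"
  proof -
    have "x \<in> convex hull (real_vec ` P)"
      using T(3) hull_mono[OF image_mono[OF TP], of convex real_vec] by blast
    also have "convex hull (real_vec ` P) = fst ` ?H"
      by (subst convex_hull_linear_image[OF linear_fst]) (simp add: image_image lift_def)
    finally show ?thesis .
  qed
  then have ne: "?H \<inter> {w. fst w = x} \<noteq> {}" by auto
  have "compact ?H" using finP by (intro finite_imp_compact_convex_hull) auto
  moreover have "closed {w :: (real ^ 't) \<times> real. fst w = x}"
    by (intro closed_Collect_eq continuous_intros)
  ultimately have "compact (?H \<inter> {w. fst w = x})" by (rule compact_Int_closed)
  moreover have "continuous_on (?H \<inter> {w. fst w = x}) snd" by (intro continuous_intros)
  ultimately obtain w where w: "w \<in> ?H" "fst w = x" and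
    wmin: "\<And>w'. w' \<in> ?H \<Longrightarrow> fst w' = x \<Longrightarrow> snd w \<le> snd w'"
    using continuous_attains_inf[of "?H \<inter> {w. fst w = x}" snd] ne by auto
  obtain u where u: "\<forall>v\<in>lift ` P. 0 \<le> u v" "sum u (lift ` P) = 1" "(\<Sum>v\<in>lift ` P. u v *\<^sub>R v) = w"
    using w(1) unfolding convex_hull_finite[OF finite_imageI[OF finP]] by blast
  define \<mu> where "\<mu> = u \<circ> lift"
  have \<mu>: "\<And>p. p \<in> P \<Longrightarrow> 0 \<le> \<mu> p" "sum \<mu> P = 1" "(\<Sum>p\<in>P. \<mu> p *\<^sub>R lift p) = w"
    using u by (auto simp: \<mu>_def sum.reindex[OF inj] o_def)
  show thesis
  proof (rule that[OF finP _ _ _ \<mu>(2)])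
    show "P \<subseteq> ?S" by (auto simp: P_def)
    show "\<forall>p\<in>P. \<forall>q\<in>P. \<forall>g\<in>int_kernel J K C. conforms g (p - q) \<longrightarrow> p - g \<in> P \<and> q + g \<in> P"
      using exch by blast
    show "\<forall>p\<in>P. 0 \<le> \<mu> p" using \<mu>(1) by blast
    show "x = (\<Sum>p\<in>P. \<mu> p *\<^sub>R real_vec p)"
      using arg_cong[OF \<mu>(3), of fst] w(2) by (simp add: fst_sum lift_def)
  next
    show "\<forall>p\<in>P. \<forall>q\<in>P. \<forall>a\<in>P. \<forall>b\<in>P. p \<noteq> q \<and> 0 < \<mu> p \<and> 0 < \<mu> q \<and> a + b = p + q \<longrightarrow>
       real_vec p \<bullet> real_vec p + real_vec q \<bullet> real_vec q \<le> real_vec a \<bullet> real_vec a + real_vec b \<bullet> real_vec b"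
    proof (intro ballI impI, elim conjE)
      fix p q a b assume pq: "p \<in> P" "q \<in> P" "p \<noteq> q" "0 < \<mu> p" "0 < \<mu> q"
        and ab: "a \<in> P" "b \<in> P" "a + b = p + q"
      define \<delta> where "\<delta> = min (\<mu> p) (\<mu> q)"
      have \<delta>: "0 < \<delta>" "\<delta> \<le> \<mu> p" "\<delta> \<le> \<mu> q" using pq by (auto simp: \<delta>_def)
      define w' where "w' = w + \<delta> *\<^sub>R (lift a - lift p) + \<delta> *\<^sub>R (lift b - lift q)"
      have "w' \<in> ?H"
        unfolding w'_def \<mu>(3)[symmetric] using finP \<mu> pq ab \<delta>
        by (intro convex_sum_exchange) (auto intro: hull_inc)
      moreover have "fst w' = x"
      proof -
        \<comment> \<open>As \<open>a + b = p + q\<close>, the exchange stays in the fibre over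
          \<open>x\<close>, where \<open>w\<close> has least height.\<close>
        have "fst w' = x + \<delta> *\<^sub>R (real_vec (a + b) - real_vec (p + q))"
          by (simp add: w'_def w(2) lift_def algebra_simps real_vec_add)
        then show ?thesis using ab(3) by simp
      qed
      ultimately have "snd w \<le> snd w'" by (rule wmin)
      then have "0 \<le> \<delta> * (real_vec a \<bullet> real_vec a + real_vec b \<bullet> real_vec b
          - (real_vec p \<bullet> real_vec p + real_vec q \<bullet> real_vec q))"
        by (simp add: w'_def lift_def algebra_simps)
      then show "real_vec p \<bullet> real_vec p + real_vec q \<bullet> real_vec q
          \<le> real_vec a \<bullet> real_vec a + real_vec b \<bullet> real_vec b"
        using \<delta>(1) by (simp add: zero_le_mult_iff)
    qed
  qed
qed

text \<open>In a minimal convex combination, the Graver elements in the decomposition of the difference of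
  two of its points have disjoint supports, for otherwise exchanging one of them between the two
  points lowers the sum of squares.\<close>

lemma graver_directions:
  fixes x :: "real ^ 't::finite"
  assumes x: "x \<in> integer_hull J K C d"
  obtains p and n :: nat and g where "p \<in> int_points J K C d"
    "\<And>F. F face_of integer_hull J K C d \<Longrightarrow> x \<in> F \<Longrightarrow> real_vec p \<in> F"
    "\<And>k. k < n \<Longrightarrow> g k \<in> graver_basis J K C"
    "\<And>k l j. k < n \<Longrightarrow> l < n \<Longrightarrow> k \<noteq> l \<Longrightarrow> g k $ j = 0 \<or> g l $ j = 0"
    "\<And>k. k < n \<Longrightarrow> \<exists>\<epsilon>>0. x + \<epsilon> *\<^sub>R real_vec (g k) \<in> integer_hull J K C d
                      \<and> x - \<epsilon> *\<^sub>R real_vec (g k) \<in> integer_hull J K C d"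
    "l1_norm (x - real_vec p) \<le> (\<Sum>k<n. real_of_int (l1_norm (g k)))"
proof -
  let ?Q = "integer_hull J K C d" and ?S = "int_points J K C d"
  obtain P \<mu> where finP: "finite P" and PS: "P \<subseteq> ?S"
    and exch: "\<forall>p\<in>P. \<forall>q\<in>P. \<forall>g\<in>int_kernel J K C. conforms g (p - q) \<longrightarrow> p - g \<in> P \<and> q + g \<in> P"
    and \<mu>_nonneg: "\<forall>p\<in>P. 0 \<le> \<mu> p" and \<mu>_sum: "sum \<mu> P = (1::real)" and x_eq: "x = (\<Sum>p\<in>P. \<mu> p *\<^sub>R real_vec p)"
    and least: "\<forall>p\<in>P. \<forall>q\<in>P. \<forall>a\<in>P. \<forall>b\<in>P. p \<noteq> q \<and> 0 < \<mu> p \<and> 0 < \<mu> q \<and> a + b = p + q \<longrightarrow>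
       real_vec p \<bullet> real_vec p + real_vec q \<bullet> real_vec q \<le> real_vec a \<bullet> real_vec a + real_vec b \<bullet> real_vec b"
    by (rule minimal_convex_combination[OF x])
  have \<mu>: "\<And>p. p \<in> P \<Longrightarrow> 0 \<le> \<mu> p" "sum \<mu> P = (1::real)" "x = (\<Sum>p\<in>P. \<mu> p *\<^sub>R real_vec p)"
    using \<mu>_nonneg \<mu>_sum x_eq by blast+
  have inQ: "real_vec a \<in> ?Q" if "a \<in> P" for a using PS that by (auto intro: real_vec_in_integer_hull)
  have "\<exists>p\<in>P. \<mu> p > 0"
  proof (rule ccontr)
    assume "\<not> ?thesis"
    then have "sum \<mu> P \<le> 0" by (intro sum_nonpos) auto
    then show False using \<mu>(2) by simp
  qed
  then obtain p where p: "p \<in> P" "\<mu> p > 0" by blast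
  let ?P' = "{a \<in> P. \<mu> a > 0}"
  have fin': "finite ?P'" and ne': "?P' \<noteq> {}" using finP p by auto
  \<comment> \<open>\<open>x\<close> is an average of points no farther from \<open>p\<close> than
    \<open>q\<close>, so the norm of \<open>q - p\<close> bounds its distance from
    \<open>p\<close>.\<close>
  obtain q where "q \<in> ?P'" and "(MAX a\<in>?P'. l1_norm (a - p)) = l1_norm (q - p)"
    by (rule obtains_MAX[OF fin' ne', of "\<lambda>a. l1_norm (a - p)"])
  then have qmax: "l1_norm (a - p) \<le> l1_norm (q - p)" if "a \<in> ?P'" for a
    using Max_ge[of "(\<lambda>a. l1_norm (a - p)) ` ?P'" "l1_norm (a - p)"] fin' that by simp
  from \<open>q \<in> ?P'\<close>
  have q: "q \<in> P" "\<mu> q > 0" by auto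
  have "l1_norm (x - real_vec p) \<le> real_of_int (l1_norm (q - p))"
  proof -
    have "x - real_vec p = (\<Sum>a\<in>P. \<mu> a *\<^sub>R real_vec a) - (\<Sum>a\<in>P. \<mu> a) *\<^sub>R real_vec p"
      using \<mu>(2,3) by simp
    also have "\<dots> = (\<Sum>a\<in>P. \<mu> a *\<^sub>R real_vec (a - p))"
      by (simp add: real_vec_diff scaleR_diff_right sum_subtractf scaleR_sum_left)
    finally have "l1_norm (x - real_vec p) \<le> (\<Sum>a\<in>P. l1_norm (\<mu> a *\<^sub>R real_vec (a - p)))"
      using l1_norm_sum[of "\<lambda>a. \<mu> a *\<^sub>R real_vec (a - p)" P] by simp
    also have "\<dots> \<le> (\<Sum>a\<in>P. \<mu> a * real_of_int (l1_norm (q - p)))"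
    proof (intro sum_mono)
      fix a assume a: "a \<in> P"
      show "l1_norm (\<mu> a *\<^sub>R real_vec (a - p)) \<le> \<mu> a * real_of_int (l1_norm (q - p))"
      proof (cases "\<mu> a > 0")
        case True
        then have "real_of_int (l1_norm (a - p)) \<le> real_of_int (l1_norm (q - p))"
          using qmax a by simp
        then show ?thesis using True by (simp add: l1_norm_scaleR)
      next
        case False
        then have "\<mu> a = 0" using \<mu>(1)[OF a] by linarith
        then show ?thesis by (simp add: l1_norm_scaleR)
      qed
    qed
    also have "\<dots> = real_of_int (l1_norm (q - p))"
      using \<mu>(2) by (simp flip: sum_distrib_right)
    finally show ?thesis .
  qed
  moreover
  have face: "real_vec p \<in> F" if F: "F face_of ?Q" "x \<in> F" for F
  proof (cases "x = real_vec p")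
    case False
    \<comment> \<open>Prolonging the segment from \<open>p\<close> beyond \<open>x\<close> by this
      factor leaves \<open>p\<close> with weight \<open>\<mu> p * \<mu> p\<close>, still
      nonnegative. So \<open>x\<close> is interior to a segment of the hull ending at
      \<open>p\<close>, and every face containing \<open>x\<close> contains
      \<open>p\<close>.\<close>
    define w where "w = x + \<mu> p *\<^sub>R (x - real_vec p)"
    have "\<mu> p \<le> 1" using member_le_sum[OF p(1), of \<mu>] \<mu> finP by auto
    have w_eq: "w = (\<Sum>a\<in>P. ((1 + \<mu> p) * \<mu> a - (if a = p then \<mu> p else 0)) *\<^sub>R real_vec a)"
    proof -
      have "(\<Sum>a\<in>P. (if a = p then \<mu> p else 0) *\<^sub>R real_vec a) = \<mu> p *\<^sub>R real_vec p"
        using finP p(1) by (simp add: if_distrib[of "\<lambda>t. t *\<^sub>R _"] cong: if_cong)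
      moreover have "w = (1 + \<mu> p) *\<^sub>R x - \<mu> p *\<^sub>R real_vec p"
        by (simp add: w_def algebra_simps)
      ultimately show ?thesis
        by (subst (asm) \<mu>(3)) (simp add: scaleR_diff_left sum_subtractf scaleR_sum_right)
    qed
    have one: "(\<Sum>a\<in>P. (1 + \<mu> p) * \<mu> a - (if a = p then \<mu> p else 0)) = 1"
      using finP p(1) \<mu>(2) by (simp add: sum_subtractf flip: sum_distrib_left)
    have nonneg: "0 \<le> (1 + \<mu> p) * \<mu> a - (if a = p then \<mu> p else 0)" if "a \<in> P" for a
      using \<mu>(1)[OF that] p(2) by (auto simp: algebra_simps)
    have w: "w \<in> ?Q"
      unfolding w_eq by (rule convex_sum[OF finP convex_integer_hull one nonneg inQ])
    have "x \<in> open_segment (real_vec p) w"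
      unfolding in_segment
    proof (intro conjI exI[of _ "1 / (1 + \<mu> p)"])
      show "real_vec p \<noteq> w"
      proof
        assume "real_vec p = w"
        then have "(1 + \<mu> p) *\<^sub>R (x - real_vec p) = 0" by (simp add: w_def algebra_simps)
        then show False using False p(2) by simp
      qed
      show "0 < 1 / (1 + \<mu> p)" "1 / (1 + \<mu> p) < 1" using p(2) by auto
      have "(1 + \<mu> p) *\<^sub>R x = \<mu> p *\<^sub>R real_vec p + w" by (simp add: w_def algebra_simps)
      then have "x = (1 / (1 + \<mu> p)) *\<^sub>R (\<mu> p *\<^sub>R real_vec p + w)"
        using p(2) by (metis divide_self_if add_pos_pos less_irrefl scaleR_one scaleR_scaleR times_divide_eq_left mult_1 zero_less_one)
      moreover have "1 - 1 / (1 + \<mu> p) = \<mu> p / (1 + \<mu> p)" using p(2) by (simp add: field_simps)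
      ultimately show "x = (1 - 1 / (1 + \<mu> p)) *\<^sub>R real_vec p + (1 / (1 + \<mu> p)) *\<^sub>R w"
        by (simp add: scaleR_add_right)
    qed
    then show ?thesis using F w inQ[OF p(1)] unfolding face_of_def by blast
  qed (use that in simp)
  ultimately show thesis
  proof (cases "p = q")
    case True
    show thesis
      by (rule that[of p 0 "\<lambda>_. 0"]) (use True p PS face \<open>l1_norm (x - real_vec p) \<le> _\<close> in auto)
  next
    case False
    have pS: "p \<in> ?S" "q \<in> ?S" using p q PS by auto
    obtain n :: nat and g where g: "\<And>k. k < n \<Longrightarrow> g k \<in> graver_basis J K C" "p - q = (\<Sum>k<n. g k)"
      and conf: "\<And>I. I \<subseteq> {..<n} \<Longrightarrow> conforms (\<Sum>k\<in>I. g k) (p - q)"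
      using graver_decomposition[OF int_points_diff[OF pS]] by metis
    have conf1: "conforms (g k) (p - q)" if "k < n" for k using conf[of "{k}"] that by simp
    have ex: "p - g k \<in> P" "q + g k \<in> P" if "k < n" for k
      using exch p(1) q(1) conf1[OF that] g(1)[OF that] graver_basis_subset by blast+
    \<comment> \<open>Replacing \<open>p\<close> and \<open>q\<close> by \<open>p - g k\<close> and
      \<open>q + g k\<close> changes the sum of squares by -2 times the inner product of
      \<open>g k\<close> with \<open>p - q - g k\<close>. Minimality makes this product nonpositive,
      sign-compatibility makes each of its terms nonnegative.\<close>
    have zero: "g k $ j * (p - q - g k) $ j = 0" if "k < n" for k j
    proof -
      let ?h = "p - q - g k"
      have nn: "0 \<le> g k $ j * ?h $ j" for j
        using conf1[OF that, unfolded conforms_def, rule_format, of j]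
        by (cases "0 \<le> (p - q) $ j") (auto simp: zero_le_mult_iff)
      have "real_vec p \<bullet> real_vec p + real_vec q \<bullet> real_vec q
        \<le> real_vec (p - g k) \<bullet> real_vec (p - g k) + real_vec (q + g k) \<bullet> real_vec (q + g k)"
        using least[rule_format, OF p(1) q(1) ex[OF that]] False p(2) q(2) by simp
      then have "real_vec (g k) \<bullet> real_vec ?h \<le> 0"
        by (simp add: real_vec_diff real_vec_add inner_simps inner_commute)
      then have "real_of_int (\<Sum>j\<in>UNIV. g k $ j * ?h $ j) \<le> 0"
        by (simp add: inner_vec_def)
      then have "(\<Sum>j\<in>UNIV. g k $ j * ?h $ j) = 0"
        unfolding of_int_le_0_iff using nn by (intro order_antisym sum_nonneg)
      then show ?thesis using nn by (simp add: sum_nonneg_eq_0_iff del: vector_minus_component)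
    qed
    show thesis
    proof (rule that[of p n g])
      show "p \<in> ?S" by fact
      show "g k \<in> graver_basis J K C" if "k < n" for k using g(1) that .
      show "real_vec p \<in> F" if "F face_of ?Q" "x \<in> F" for F using face that .
    next
      fix k l j assume kl: "k < n" "l < n" "k \<noteq> l"
      \<comment> \<open>Where \<open>g k\<close> is nonzero it exhausts \<open>p - q\<close>, and
        conformity of the sum leaves nothing for \<open>g l\<close>.\<close>
      have "conforms (g k + g l) (p - q)" using conf[of "{k, l}"] kl by simp
      then show "g k $ j = 0 \<or> g l $ j = 0"
        using zero[OF kl(1), of j] conf1[OF kl(2)] unfolding conforms_def
        by (cases "0 \<le> (p - q) $ j") (auto, (smt (verit))+)
    next
      fix k assume k: "k < n"
      define \<epsilon> where "\<epsilon> = min (\<mu> p) (\<mu> q)"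
      have \<epsilon>: "\<epsilon> > 0" "\<epsilon> \<le> \<mu> p" "\<epsilon> \<le> \<mu> q" using p q by (auto simp: \<epsilon>_def)
      \<comment> \<open>Replacing only \<open>q\<close> by \<open>q + g k\<close> moves
        \<open>x\<close> forward along \<open>g k\<close>; replacing only \<open>p\<close> by
        \<open>p - g k\<close> moves it back.\<close>
      have step: "x + \<epsilon> *\<^sub>R (c - real_vec p) + \<epsilon> *\<^sub>R (c' - real_vec q) \<in> ?Q"
        if "c \<in> ?Q" "c' \<in> ?Q" for c c'
        unfolding \<mu>(3) using that
        by (intro convex_sum_exchange convex_integer_hull finP inQ \<mu>(1,2) p(1) q(1) False \<epsilon>)
      have "x + \<epsilon> *\<^sub>R real_vec (g k) \<in> ?Q"
        using step[OF inQ[OF p(1)] inQ[OF ex(2)[OF k]]] by (simp add: real_vec_add)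
      moreover have "x - \<epsilon> *\<^sub>R real_vec (g k) \<in> ?Q"
        using step[OF inQ[OF ex(1)[OF k]] inQ[OF q(1)]] by (simp add: real_vec_diff)
      ultimately show "\<exists>\<epsilon>>0. x + \<epsilon> *\<^sub>R real_vec (g k) \<in> ?Q \<and> x - \<epsilon> *\<^sub>R real_vec (g k) \<in> ?Q"
        using \<epsilon> by blast
    next
      have "l1_norm (q - p) = l1_norm (p - q)" by (metis l1_norm_minus minus_diff_eq)
      also have "\<dots> \<le> (\<Sum>k<n. l1_norm (g k))" unfolding g(2) by (rule l1_norm_sum)
      finally have "real_of_int (l1_norm (q - p)) \<le> (\<Sum>k<n. real_of_int (l1_norm (g k)))"
        by (simp only: of_int_le_iff flip: of_int_sum)
      then show "l1_norm (x - real_vec p) \<le> (\<Sum>k<n. real_of_int (l1_norm (g k)))"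
        using \<open>l1_norm (x - real_vec p) \<le> _\<close> by linarith
    qed
  qed
qed

section \<open>Vertices and proximity\<close>

lemma real_mat_mult: "real_mat A *v real_vec u = real_vec (A *v u)"
  by (simp add: vec_eq_iff real_mat_def matrix_vector_mult_def)

lemma matrix_vector_mult_sum_right:
  fixes A :: "'a::comm_ring_1 ^ 't::finite ^ 'm::finite"
  shows "A *v sum f S = (\<Sum>a\<in>S. A *v f a)"
  by (induction S rule: infinite_finite_induct) (auto simp: matrix_vector_right_distrib)

lemma matrix_vector_mult_bound:
  assumes "w \<in> vecs_on J" "\<And>j. j \<in> J \<Longrightarrow> \<bar>A $ k $ j\<bar> \<le> D"
  shows "\<bar>(A *v w) $ k\<bar> \<le> D * l1_norm (w :: real ^ 't::finite)"
proof -
  have "\<bar>(A *v w) $ k\<bar> \<le> (\<Sum>j\<in>UNIV. \<bar>A $ k $ j * w $ j\<bar>)"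
    by (simp add: matrix_vector_mult_def sum_abs)
  also have "\<dots> \<le> (\<Sum>j\<in>UNIV. D * \<bar>w $ j\<bar>)"
  proof (rule sum_mono)
    fix j
    show "\<bar>A $ k $ j * w $ j\<bar> \<le> D * \<bar>w $ j\<bar>"
      using assms by (cases "j \<in> J") (auto simp: vecs_on_def abs_mult intro: mult_right_mono)
  qed
  also have "\<dots> = D * l1_norm w" by (simp add: l1_norm_def sum_distrib_left)
  finally show ?thesis .
qed

lemma integer_hull_subset_vecs_on: "integer_hull J K C d \<subseteq> vecs_on J"
proof -
  have "convex (vecs_on J :: (real ^ 'a) set)" by (auto simp: convex_def vecs_on_def)
  then show ?thesis
    unfolding integer_hull_eq by (intro hull_minimal) (auto simp: int_points_def vecs_on_def)
qed

text \<open>For convex \<open>Q\<close> containing \<open>x\<close> these directions form a linear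
  subspace, so arbitrary real combinations of them are available.\<close>

definition two_sided_direction :: "'a::real_vector set \<Rightarrow> 'a \<Rightarrow> 'a \<Rightarrow> bool" where
  "two_sided_direction Q x u \<longleftrightarrow> (\<exists>\<epsilon>>0. x + \<epsilon> *\<^sub>R u \<in> Q \<and> x - \<epsilon> *\<^sub>R u \<in> Q)"

lemma two_sided_direction_scaleR:
  assumes "x \<in> Q" "two_sided_direction Q x u"
  shows "two_sided_direction Q x (c *\<^sub>R u)"
proof -
  obtain \<epsilon> where e: "\<epsilon> > 0" "x + \<epsilon> *\<^sub>R u \<in> Q" "x - \<epsilon> *\<^sub>R u \<in> Q"
    using assms(2) by (auto simp: two_sided_direction_def)
  consider "c = 0" | "c > 0" | "c < 0" by linarith
  then show ?thesis
  proof cases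
    case 1
    then show ?thesis using assms(1) by (auto simp: two_sided_direction_def intro: exI[of _ 1])
  next
    case 2
    then show ?thesis unfolding two_sided_direction_def
      using e by (intro exI[of _ "\<epsilon> / c"]) auto
  next
    case 3
    then show ?thesis unfolding two_sided_direction_def
      using e by (intro exI[of _ "\<epsilon> / (- c)"]) (auto simp: divide_pos_neg)
  qed
qed

lemma two_sided_direction_add:
  assumes Q: "convex Q" "x \<in> Q" and "two_sided_direction Q x u" "two_sided_direction Q x v"
  shows "two_sided_direction Q x (u + v)"
proof -
  obtain \<epsilon> where e: "\<epsilon> > 0" "x + \<epsilon> *\<^sub>R u \<in> Q" "x + \<epsilon> *\<^sub>R (- u) \<in> Q"
    using assms(3) by (auto simp: two_sided_direction_def)
  obtain \<epsilon>' where e': "\<epsilon>' > 0" "x + \<epsilon>' *\<^sub>R v \<in> Q" "x + \<epsilon>' *\<^sub>R (- v) \<in> Q"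
    using assms(4) by (auto simp: two_sided_direction_def)
  define \<delta> where "\<delta> = min \<epsilon> \<epsilon>'"
  have \<delta>: "0 < \<delta>" "0 \<le> \<delta>" "\<delta> \<le> \<epsilon>" "\<delta> \<le> \<epsilon>'" using e e' by (auto simp: \<delta>_def)
  have mid: "x + (\<delta> / 2) *\<^sub>R (a + b) \<in> Q" if "x + \<delta> *\<^sub>R a \<in> Q" "x + \<delta> *\<^sub>R b \<in> Q" for a b
  proof -
    have "(1 / 2) *\<^sub>R (x + \<delta> *\<^sub>R a) + (1 / 2) *\<^sub>R (x + \<delta> *\<^sub>R b) \<in> Q"
      using that Q(1) by (intro convexD) auto
    also have "(1 / 2) *\<^sub>R (x + \<delta> *\<^sub>R a) + (1 / 2) *\<^sub>R (x + \<delta> *\<^sub>R b)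
        = (1 / 2 + 1 / 2 :: real) *\<^sub>R x + (\<delta> / 2) *\<^sub>R (a + b)"
      unfolding scaleR_add_left scaleR_add_right by simp
    finally show ?thesis by simp
  qed
  have "x + (\<delta> / 2) *\<^sub>R (u + v) \<in> Q"
    by (intro mid convex_step[OF Q e(2) \<delta>(2,3)] convex_step[OF Q e'(2) \<delta>(2,4)])
  moreover have "x + (\<delta> / 2) *\<^sub>R (- u + - v) \<in> Q"
    by (intro mid convex_step[OF Q e(3) \<delta>(2,3)] convex_step[OF Q e'(3) \<delta>(2,4)])
  moreover have "x + (\<delta> / 2) *\<^sub>R (- u + - v) = x - (\<delta> / 2) *\<^sub>R (u + v)"
    by (simp add: algebra_simps)
  ultimately show ?thesis
    unfolding two_sided_direction_def using \<delta>(1) by (intro exI[of _ "\<delta> / 2"]) simp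
qed

lemma two_sided_direction_sum:
  assumes "convex Q" "x \<in> Q" "\<And>a. a \<in> S \<Longrightarrow> two_sided_direction Q x (f a)"
  shows "two_sided_direction Q x (sum f S)"
  using assms(3)
proof (induction S rule: infinite_finite_induct)
  case (insert a S)
  then show ?case using assms(1,2) by (simp add: two_sided_direction_add)
qed (use assms(2) in \<open>auto simp: two_sided_direction_def intro: exI[of _ 1]\<close>)

section \<open>Moving all blocks at once\<close>

lemma common_step:
  fixes Q :: "'n::finite \<Rightarrow> 'a::real_vector set"
  assumes "\<And>i. convex (Q i)" "\<And>i. x i \<in> Q i" "\<And>i. \<exists>\<epsilon>>0. x i + \<epsilon> *\<^sub>R u i \<in> Q i"
  obtains \<epsilon>0 where "\<epsilon>0 > 0" "\<And>i \<epsilon>. 0 \<le> \<epsilon> \<Longrightarrow> \<epsilon> \<le> \<epsilon>0 \<Longrightarrow> x i + \<epsilon> *\<^sub>R u i \<in> Q i"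
proof -
  obtain e where e: "\<And>i. e i > 0" "\<And>i. x i + e i *\<^sub>R u i \<in> Q i" using assms(3) by metis
  show thesis
  proof (rule that)
    show "Min (range e) > 0" using e(1) by simp
    fix i \<epsilon> assume \<epsilon>: "0 \<le> \<epsilon>" "\<epsilon> \<le> Min (range e)"
    then have "\<epsilon> \<le> e i" by (simp add: Min_ge_iff)
    then show "x i + \<epsilon> *\<^sub>R u i \<in> Q i"
      using convex_step[OF assms(1,2) e(2)] \<epsilon>(1) by blast
  qed
qed

lemma lp_feasible_step:
  fixes x u :: "real ^ 't::finite ^ 'n::finite"
  assumes "x \<in> lp_feasible A b0 Q" "(\<Sum>i\<in>UNIV. real_mat (A i) *v (u $ i)) = 0"
    "\<And>i. x $ i + \<epsilon> *\<^sub>R u $ i \<in> Q i"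
  shows "x + \<epsilon> *\<^sub>R u \<in> lp_feasible A b0 Q"
  using assms
  by (simp add: lp_feasible_def matrix_vector_right_distrib matrix_vector_mult_scaleR sum.distrib
      flip: scaleR_sum_right)

text \<open>More than \<open>CARD('r)\<close> directions have linearly dependent images. The
  dependence gives a direction that the coupling constraint does not see, nonzero by disjointness of
  supports, and makes \<open>x\<close> the midpoint of a feasible segment.\<close>

lemma vertex_directions_le:
  fixes x :: "real ^ 't::finite ^ 'n::finite" and A :: "'n \<Rightarrow> int ^ 't ^ 'r::finite"
    and g :: "'n \<Rightarrow> nat \<Rightarrow> int ^ 't"
  assumes vertex: "x extreme_point_of lp_feasible A b0 Q"
    and convex: "\<And>i. convex (Q i)"
    and nz: "\<And>i k. k < n i \<Longrightarrow> g i k \<noteq> 0"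
    and disj: "\<And>i k l j. k < n i \<Longrightarrow> l < n i \<Longrightarrow> k \<noteq> l \<Longrightarrow> g i k $ j = 0 \<or> g i l $ j = 0"
    and dir: "\<And>i k. k < n i \<Longrightarrow> two_sided_direction (Q i) (x $ i) (real_vec (g i k))"
  shows "(\<Sum>i\<in>UNIV. n i) \<le> CARD('r)"
proof (rule ccontr)
  assume many: "\<not> ?thesis"
  have x: "x \<in> lp_feasible A b0 Q" using vertex by (simp add: extreme_point_of_def)
  then have xQ: "x $ i \<in> Q i" for i by (simp add: lp_feasible_def)
  let ?E = "SIGMA i:(UNIV :: 'n set). {..<n i}"
  have fin: "finite ?E" by simp
  have "card ?E > DIM(real ^ 'r)" using many by simp
  then obtain \<alpha> where \<alpha>: "\<exists>e\<in>?E. \<alpha> e \<noteq> 0"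
    "(\<Sum>e\<in>?E. \<alpha> e *\<^sub>R (case e of (i, k) \<Rightarrow> real_mat (A i) *v real_vec (g i k))) = 0"
    by (rule dependent_family[OF fin])
  define u :: "real ^ 't ^ 'n" where "u = (\<chi> i. \<Sum>k<n i. \<alpha> (i, k) *\<^sub>R real_vec (g i k))"
  have "(\<Sum>i\<in>UNIV. real_mat (A i) *v (u $ i))
      = (\<Sum>i\<in>UNIV. \<Sum>k<n i. \<alpha> (i, k) *\<^sub>R (real_mat (A i) *v real_vec (g i k)))"
    by (simp add: u_def matrix_vector_mult_scaleR matrix_vector_mult_sum_right)
  also have "\<dots> = 0"
    using \<alpha>(2) by (subst sum.Sigma) (auto simp: case_prod_unfold)
  finally have Au: "(\<Sum>i\<in>UNIV. real_mat (A i) *v (u $ i)) = 0" .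
  have dir_u: "two_sided_direction (Q i) (x $ i) (u $ i)" for i
    unfolding u_def vec_lambda_beta
    by (intro two_sided_direction_sum two_sided_direction_scaleR convex xQ dir) auto
  have dir_plus: "\<exists>\<epsilon>>0. x $ i + \<epsilon> *\<^sub>R u $ i \<in> Q i"
    and dir_minus: "\<exists>\<epsilon>>0. x $ i + \<epsilon> *\<^sub>R (- u) $ i \<in> Q i" for i
    using dir_u[of i] by (auto simp: two_sided_direction_def)
  obtain \<epsilon>1 where \<epsilon>1: "\<epsilon>1 > 0" "\<And>i \<epsilon>. 0 \<le> \<epsilon> \<Longrightarrow> \<epsilon> \<le> \<epsilon>1 \<Longrightarrow> x $ i + \<epsilon> *\<^sub>R u $ i \<in> Q i"
    by (rule common_step[where Q = Q and x = "($) x" and u = "($) u", OF convex xQ dir_plus]) blast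
  obtain \<epsilon>2 where \<epsilon>2: "\<epsilon>2 > 0" "\<And>i \<epsilon>. 0 \<le> \<epsilon> \<Longrightarrow> \<epsilon> \<le> \<epsilon>2 \<Longrightarrow> x $ i + \<epsilon> *\<^sub>R (- u) $ i \<in> Q i"
    by (rule common_step[where Q = Q and x = "($) x" and u = "($) (- u)", OF convex xQ dir_minus]) blast
  define \<epsilon> where "\<epsilon> = min \<epsilon>1 \<epsilon>2"
  have \<epsilon>: "\<epsilon> > 0" "\<epsilon> \<le> \<epsilon>1" "\<epsilon> \<le> \<epsilon>2" using \<epsilon>1(1) \<epsilon>2(1) by (auto simp: \<epsilon>_def)
  have plus: "x + \<epsilon> *\<^sub>R u \<in> lp_feasible A b0 Q"
    using \<epsilon> \<epsilon>1(2) by (intro lp_feasible_step[OF x Au]) auto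
  have "(\<Sum>i\<in>UNIV. real_mat (A i) *v ((- u) $ i)) = 0"
    using Au by (simp add: sum_negf linear_neg[OF matrix_vector_mul_linear])
  then have minus: "x + \<epsilon> *\<^sub>R (- u) \<in> lp_feasible A b0 Q"
    using \<epsilon> \<epsilon>2(2) by (intro lp_feasible_step[OF x]) auto
  \<comment> \<open>At a coordinate in the support of \<open>g i k\<close> no other direction of
    block \<open>i\<close> contributes, so nothing can cancel.\<close>
  obtain i k where ik: "k < n i" "\<alpha> (i, k) \<noteq> 0" using \<alpha>(1) by auto
  then obtain j where j: "g i k $ j \<noteq> 0" using nz by (metis vec_eq_iff zero_index)
  have "u $ i $ j = (\<Sum>l<n i. \<alpha> (i, l) * real_of_int (g i l $ j))"
    by (simp add: u_def)
  also have "\<dots> = (\<Sum>l\<in>{k}. \<alpha> (i, l) * real_of_int (g i l $ j))"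
    using ik(1) j disj[of k i] by (intro sum.mono_neutral_right) auto
  finally have "u $ i $ j \<noteq> 0" using ik j by simp
  then have "u \<noteq> 0" by auto
  have "x \<in> open_segment (x + \<epsilon> *\<^sub>R (- u)) (x + \<epsilon> *\<^sub>R u)"
    unfolding in_segment
  proof (intro conjI exI[of _ "1/2"])
    show "x + \<epsilon> *\<^sub>R (- u) \<noteq> x + \<epsilon> *\<^sub>R u"
    proof
      assume "x + \<epsilon> *\<^sub>R (- u) = x + \<epsilon> *\<^sub>R u"
      then have "(2 * \<epsilon>) *\<^sub>R u = 0" by (simp add: algebra_simps scaleR_2 flip: scaleR_scaleR)
      then show False using \<open>u \<noteq> 0\<close> \<epsilon>(1) by simp
    qed
    have "(1 - 1 / 2) *\<^sub>R (x + \<epsilon> *\<^sub>R (- u)) + (1 / 2) *\<^sub>R (x + \<epsilon> *\<^sub>R u) = (1 / 2 + 1 / 2 :: real) *\<^sub>R x"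
      unfolding scaleR_add_left scaleR_add_right by simp
    then show "x = (1 - 1 / 2) *\<^sub>R (x + \<epsilon> *\<^sub>R (- u)) + (1 / 2) *\<^sub>R (x + \<epsilon> *\<^sub>R u)" by simp
  qed auto
  then show False using vertex plus minus unfolding extreme_point_of_def by blast
qed

text \<open>Vectors conforming to the same \<open>u\<close> cannot cancel; a vanishing block sum
  thus has vanishing members.\<close>

lemma conforms_add_eq_0: "conforms a u \<Longrightarrow> conforms b u \<Longrightarrow> a + b = 0 \<Longrightarrow> a = 0"
proof -
  assume *: "conforms a u" "conforms b u" "a + b = 0"
  have "a $ j = 0" for j
  proof -
    have "a $ j + b $ j = 0" using *(3) by (metis vector_add_component zero_index)
    then show ?thesis using *(1,2)[unfolded conforms_def, rule_format, of j]
      by (cases "0 \<le> u $ j") auto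
  qed
  then show "a = 0" by (simp add: vec_eq_iff)
qed

lemma objective_add: "objective c (x + y) = objective c x + objective c y"
  by (simp add: objective_def inner_add_right sum.distrib)

lemma objective_diff: "objective c (x - y) = objective c x - objective c y"
  by (simp add: objective_def inner_diff_right sum_subtractf)

lemma objective_scaleR: "objective c (a *\<^sub>R x) = a * objective c x"
  by (simp add: objective_def sum_distrib_left)

text \<open>Moving from \<open>z\<close> towards \<open>y\<close> by \<open>w\<close> keeps integer feasibility, and \<open>w\<close> is a feasible direction
  of the linear program at \<open>x\<close>. So \<open>w\<close> cannot change the objective, and \<open>z - w\<close> would be an optimal
  solution closer to \<open>y\<close>.\<close>

lemma conforming_exchange_trivial:
  fixes A :: "'n::finite \<Rightarrow> int ^ 't::finite ^ 'r::finite" and B :: "'n \<Rightarrow> int ^ 't ^ 'm::finite"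
    and x y z c :: "real ^ 't ^ 'n" and w :: "'n \<Rightarrow> int ^ 't"
  assumes Q: "\<And>i. Q i = integer_hull (J i) (K i) (B i) (b i)"
    and x_optimal: "is_arg_max (objective c) (\<lambda>v. v \<in> lp_feasible A b0 Q) x"
    and F: "\<And>i. minimal_face (Q i) (x $ i) (F i)" and yF: "\<And>i. y $ i \<in> F i"
    and z: "is_arg_min (\<lambda>w. block_l1_norm (y - w))
              (is_arg_max (objective c) (\<lambda>v. v \<in> ip_feasible A b0 Q)) z"
    and y_int: "\<And>i. ya i \<in> int_points (J i) (K i) (B i) (b i)" "\<And>i. y $ i = real_vec (ya i)"
    and z_int: "\<And>i. za i \<in> int_points (J i) (K i) (B i) (b i)" "\<And>i. z $ i = real_vec (za i)"
    and w: "\<And>i. w i \<in> int_kernel (J i) (K i) (B i)" "\<And>i. conforms (w i) (za i - ya i)"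
      "(\<Sum>i\<in>UNIV. A i *v w i) = 0"
  shows "w i = 0"
proof (rule ccontr)
  assume nz: "w i \<noteq> 0"
  define W :: "real ^ 't ^ 'n" where "W = (\<chi> i. real_vec (w i))"
  have AW: "(\<Sum>i\<in>UNIV. real_mat (A i) *v (W $ i)) = 0"
    using w(3) by (simp add: W_def real_mat_mult flip: real_vec_sum)
  have AW': "(\<Sum>i\<in>UNIV. real_mat (A i) *v ((- W) $ i)) = 0"
    using AW by (simp add: sum_negf linear_neg[OF matrix_vector_mul_linear])
  have zmax: "z \<in> ip_feasible A b0 Q" "\<And>v. v \<in> ip_feasible A b0 Q \<Longrightarrow> objective c v \<le> objective c z"
    and zmin: "\<And>v. is_arg_max (objective c) (\<lambda>v. v \<in> ip_feasible A b0 Q) v \<Longrightarrow>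
        block_l1_norm (y - z) \<le> block_l1_norm (y - v)"
    using z by (auto simp: is_arg_min_def is_arg_max_def not_less)
  have zW: "(z + 1 *\<^sub>R (- W)) $ i = real_vec (za i - w i)" for i
    by (simp add: W_def z_int(2) real_vec_diff)
  have zW': "za i - w i \<in> int_points (J i) (K i) (B i) (b i)"
    and yW: "ya i + w i \<in> int_points (J i) (K i) (B i) (b i)" for i
    using int_points_exchange[OF z_int(1) y_int(1) w(1,2)] by auto
  have "z + 1 *\<^sub>R (- W) \<in> lp_feasible A b0 Q"
  proof (rule lp_feasible_step[OF _ AW'])
    show "z \<in> lp_feasible A b0 Q" using zmax(1) by (simp add: ip_feasible_def)
    show "z $ i + 1 *\<^sub>R (- W) $ i \<in> Q i" for i
      using zW[of i] real_vec_in_integer_hull[OF zW'[of i]] by (simp add: Q)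
  qed
  then have feas: "z + 1 *\<^sub>R (- W) \<in> ip_feasible A b0 Q"
    unfolding ip_feasible_def using zW by simp
  have obj: "objective c (z + 1 *\<^sub>R (- W)) = objective c z - objective c W"
    by (simp add: objective_diff)
  \<comment> \<open>\<open>y + W\<close> lies in the blocks, so \<open>W\<close> is feasible at
    \<open>x\<close> for a small step, and a positive value would improve \<open>x\<close>. Hence
    subtracting \<open>W\<close> from \<open>z\<close> loses nothing.\<close>
  have "objective c W \<le> 0"
  proof (rule ccontr)
    assume pos: "\<not> ?thesis"
    have x: "x \<in> lp_feasible A b0 Q" "\<And>v. v \<in> lp_feasible A b0 Q \<Longrightarrow> objective c v \<le> objective c x"
      using x_optimal by (auto simp: is_arg_max_def not_less)
    have convex: "convex (Q i)" for i by (simp add: Q convex_integer_hull)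
    have "\<exists>\<epsilon>>0. x $ i + \<epsilon> *\<^sub>R W $ i \<in> Q i" for i
    proof (rule minimal_face_feasible_direction[OF convex F yF])
      show "y $ i + W $ i \<in> Q i"
        using real_vec_in_integer_hull[OF yW[of i]] by (simp add: Q W_def y_int(2) real_vec_add)
    qed
    note dir = this
    have xQ: "x $ i \<in> Q i" for i using x(1) by (simp add: lp_feasible_def)
    obtain \<epsilon> where \<epsilon>: "\<epsilon> > 0" "\<And>i \<delta>. 0 \<le> \<delta> \<Longrightarrow> \<delta> \<le> \<epsilon> \<Longrightarrow> x $ i + \<delta> *\<^sub>R W $ i \<in> Q i"
      by (rule common_step[where Q = Q and x = "($) x" and u = "($) W", OF convex xQ dir]) blast
    have "x + \<epsilon> *\<^sub>R W \<in> lp_feasible A b0 Q"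
      using \<epsilon> by (intro lp_feasible_step[OF x(1) AW]) auto
    then have "objective c x + \<epsilon> * objective c W \<le> objective c x"
      using x(2) by (metis objective_add objective_scaleR)
    then show False using pos \<epsilon>(1) by (simp add: mult_le_0_iff)
  qed
  then have "objective c v \<le> objective c (z + 1 *\<^sub>R (- W))" if "v \<in> ip_feasible A b0 Q" for v
    using zmax(2)[OF that] obj by linarith
  then have "is_arg_max (objective c) (\<lambda>v. v \<in> ip_feasible A b0 Q) (z + 1 *\<^sub>R (- W))"
    using feas unfolding is_arg_max_def not_less by (meson not_less)
  then have "block_l1_norm (y - z) \<le> block_l1_norm (y - (z + 1 *\<^sub>R (- W)))" by (rule zmin)
  \<comment> \<open>By conformity the distance drops by exactly the norm of \<open>w\<close>, which
    is positive.\<close>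
  moreover have "block_l1_norm (y - (z + 1 *\<^sub>R (- W))) = (\<Sum>i\<in>UNIV. real_of_int (l1_norm (za i - ya i) - l1_norm (w i)))"
    unfolding block_l1_norm_def
  proof (intro sum.cong refl)
    fix i
    have "(y - (z + 1 *\<^sub>R (- W))) $ i = - real_vec (za i - ya i - w i)"
      unfolding vector_minus_component zW by (simp add: y_int(2) real_vec_diff)
    then show "l1_norm ((y - (z + 1 *\<^sub>R (- W))) $ i) = real_of_int (l1_norm (za i - ya i) - l1_norm (w i))"
      using l1_norm_conforms_diff[OF w(2)[of i]] by simp
  qed
  moreover have "block_l1_norm (y - z) = (\<Sum>i\<in>UNIV. real_of_int (l1_norm (za i - ya i)))"
    unfolding block_l1_norm_def
  proof (intro sum.cong refl)
    fix i
    have "(y - z) $ i = - real_vec (za i - ya i)" by (simp add: y_int(2) z_int(2) real_vec_diff)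
    then show "l1_norm ((y - z) $ i) = real_of_int (l1_norm (za i - ya i))" by simp
  qed
  ultimately have "(\<Sum>i\<in>UNIV. real_of_int (l1_norm (w i))) \<le> 0" by (simp add: sum_subtractf)
  moreover have "0 < (\<Sum>i\<in>UNIV. real_of_int (l1_norm (w i)))"
    using nz by (intro sum_pos2[of _ i]) (auto simp: order_less_le)
  ultimately show False by simp
qed

lemma proximity_arith:
  fixes r D H N :: nat and \<Delta> G :: real
  assumes count: "N + r + 1 \<le> (r + 1) * (2 * (r * (D * H)) + 1) ^ r"
    and D: "real D \<le> \<Delta>" and H: "real H \<le> G" and r: "r \<ge> 1"
  shows "real (N * H) \<le> (2 * real r * \<Delta> * G + 1) ^ (r + 4)"
proof -
  define P where "P = 2 * (r * (D * H)) + 1"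
  have nonneg: "0 \<le> \<Delta>" "0 \<le> G" using D H by linarith+
  have "N * H \<le> P ^ (r + 4)"
  proof (cases "D * H = 0")
    \<comment> \<open>Here the box is a single point and the count leaves no room for any
      element.\<close>
    case True
    then have "2 * (r * (D * H)) + 1 = 1" by simp
    then have "N + r + 1 \<le> (r + 1) * 1 ^ r" using count by (simp only:)
    then have "N = 0" by simp
    then show ?thesis by simp
  next
    case False
    then have DH: "1 \<le> D * H" "H \<le> D * H" by auto
    have "r * 1 \<le> r * (D * H)" using DH by (intro mult_le_mono) auto
    then have r1: "r + 1 \<le> P" by (simp add: P_def)
    have "1 * (D * H) \<le> r * (D * H)" using r by (intro mult_le_mono) auto
    then have HP: "H \<le> P" using DH(2) unfolding P_def by linarith
    have "N + r + 1 \<le> (r + 1) * P ^ r" using count by (simp only: P_def)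
    also have "\<dots> \<le> P * P ^ r" using r1 by (rule mult_le_mono1)
    finally have "N \<le> P * P ^ r" by linarith
    then have "N * H \<le> P * P ^ r * P" using HP by (intro mult_le_mono)
    also have "\<dots> = P ^ (r + 2)" by (simp add: power_add power2_eq_square)
    also have "\<dots> \<le> P ^ (r + 4)" by (intro power_increasing) (auto simp: P_def)
    finally show ?thesis .
  qed
  then have "real (N * H) \<le> real P ^ (r + 4)" by (simp only: flip: of_nat_power of_nat_le_iff)
  also have "\<dots> \<le> (2 * real r * \<Delta> * G + 1) ^ (r + 4)"
  proof (rule power_mono)
    have "real D * real H \<le> \<Delta> * G" using D H nonneg by (intro mult_mono) auto
    then have "2 * real r * (real D * real H) \<le> 2 * real r * (\<Delta> * G)" by (intro mult_left_mono) auto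
    then show "real P \<le> 2 * real r * \<Delta> * G + 1" by (simp add: P_def mult.assoc)
  qed simp
  finally show ?thesis .
qed

theorem theorem5:
  fixes J :: "'n::finite \<Rightarrow> 't::finite set"
    and K :: "'n \<Rightarrow> 'm::finite set"
    and A :: "'n \<Rightarrow> int ^ 't ^ 'r::finite"
    and B :: "'n \<Rightarrow> int ^ 't ^ 'm"
    and b0 :: "int ^ 'r"
    and b :: "'n \<Rightarrow> int ^ 'm"
    and c :: "real ^ 't ^ 'n"
    and \<Delta> G :: real
    and Q F :: "'n \<Rightarrow> (real ^ 't) set"
    and x y z :: "real ^ 't ^ 'n"
  assumes Delta_nonneg: "0 \<le> \<Delta>"
    and A_bound: "\<And>i k j. j \<in> J i \<Longrightarrow> \<bar>real_of_int (A i $ k $ j)\<bar> \<le> \<Delta>"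
    and Q: "\<And>i. Q i = integer_hull (J i) (K i) (B i) (b i)"
    and G_nonneg: "0 \<le> G"
    and G_bound: "\<And>i u. u \<in> graver_basis (J i) (K i) (B i) \<Longrightarrow> real_of_int (l1_norm u) \<le> G"
    and x_optimal: "is_arg_max (objective c) (\<lambda>v. v \<in> lp_feasible A b0 Q) x"
    and x_vertex: "x extreme_point_of lp_feasible A b0 Q"
    and F: "\<And>i. minimal_face (Q i) (x $ i) (F i)"
    and y: "\<And>i. is_arg_min (\<lambda>w. l1_norm (x $ i - w)) (\<lambda>w. w \<in> F i \<and> integral_vec w) (y $ i)"
    and z: "is_arg_min (\<lambda>w. block_l1_norm (y - w))
              (is_arg_max (objective c) (\<lambda>v. v \<in> ip_feasible A b0 Q)) z"
  shows "block_l1_norm (y - z) \<le> (2 * real CARD('r) * \<Delta> * G + 1) ^ (CARD('r) + 4)"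
proof -
  \<comment> \<open>The bounded quantities are integers, so the rounded bounds hold as well, and
    lattice points can be counted with them.\<close>
  define D H where "D = nat \<lfloor>\<Delta>\<rfloor>" and "H = nat \<lfloor>G\<rfloor>"
  have D: "real D \<le> \<Delta>" and H: "real H \<le> G"
    using Delta_nonneg G_nonneg by (simp_all add: D_def H_def)
  have AD: "\<bar>real_mat (A i) $ k $ j\<bar> \<le> real D" if "j \<in> J i" for i k j
  proof -
    have "\<bar>A i $ k $ j\<bar> \<le> \<lfloor>\<Delta>\<rfloor>" using A_bound[OF that, of k] by (simp add: le_floor_iff)
    then have "\<bar>A i $ k $ j\<bar> \<le> int D" using Delta_nonneg by (simp add: D_def)
    then show ?thesis by (simp add: real_mat_def flip: of_int_abs)
  qed
  have GH: "l1_norm u \<le> int H" if "u \<in> graver_basis (J i) (K i) (B i)" for i u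
  proof -
    have "l1_norm u \<le> \<lfloor>G\<rfloor>" using G_bound[OF that] by (simp add: le_floor_iff)
    then show ?thesis using G_nonneg by (simp add: H_def)
  qed
  have GHr: "real_of_int (l1_norm u) \<le> real H" if "u \<in> graver_basis (J i) (K i) (B i)" for i u
  proof -
    have "real_of_int (l1_norm u) \<le> real_of_int (int H)"
      unfolding of_int_le_iff by (rule GH[OF that])
    then show ?thesis by simp
  qed
  have x: "x \<in> lp_feasible A b0 Q" using x_optimal by (simp add: is_arg_max_def)
  have xQ: "x $ i \<in> integer_hull (J i) (K i) (B i) (b i)" for i
    using x by (simp add: lp_feasible_def Q)
  have FQ: "F i face_of Q i" "x $ i \<in> F i" for i using F by (auto simp: minimal_face_def)
  have yF: "y $ i \<in> F i" "integral_vec (y $ i)"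
    and y_min: "\<And>w. w \<in> F i \<Longrightarrow> integral_vec w \<Longrightarrow> l1_norm (x $ i - y $ i) \<le> l1_norm (x $ i - w)" for i
    using y[of i] by (auto simp: is_arg_min_def not_less)
  have "y $ i \<in> integer_hull (J i) (K i) (B i) (b i)" for i
    using yF(1) FQ(1)[of i] face_of_imp_subset by (auto simp: Q)
  then have "\<exists>u. u \<in> int_points (J i) (K i) (B i) (b i) \<and> y $ i = real_vec u" for i
    using integral_in_integer_hull yF(2) by metis
  then obtain ya where ya: "\<And>i. ya i \<in> int_points (J i) (K i) (B i) (b i)" "\<And>i. y $ i = real_vec (ya i)"
    by metis
  have zf: "z \<in> ip_feasible A b0 Q" using z by (simp add: is_arg_min_def is_arg_max_def)
  have "\<exists>u. u \<in> int_points (J i) (K i) (B i) (b i) \<and> z $ i = real_vec u" for i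
  proof -
    have "z $ i \<in> integer_hull (J i) (K i) (B i) (b i)" "integral_vec (z $ i)"
      using zf by (auto simp: ip_feasible_def lp_feasible_def Q)
    then show ?thesis by (metis integral_in_integer_hull)
  qed
  then obtain za where za: "\<And>i. za i \<in> int_points (J i) (K i) (B i) (b i)" "\<And>i. z $ i = real_vec (za i)"
    by metis

  have near: "(\<Sum>i\<in>UNIV. l1_norm (x $ i - y $ i)) \<le> real CARD('r) * real H"
  proof -
    define good where "good i n g \<longleftrightarrow> (\<forall>k<n. g k \<in> graver_basis (J i) (K i) (B i)) \<and>
      (\<forall>k<n. \<forall>l<n. \<forall>j. k \<noteq> l \<longrightarrow> g k $ j = 0 \<or> g l $ j = 0) \<and>
      (\<forall>k<n. two_sided_direction (Q i) (x $ i) (real_vec (g k))) \<and>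
      l1_norm (x $ i - y $ i) \<le> (\<Sum>k<n. real_of_int (l1_norm (g k)))"
      for i and n :: nat and g
    have "\<exists>n g. good i n g" for i
    proof -
      obtain p and n :: nat and g where "p \<in> int_points (J i) (K i) (B i) (b i)"
        and face: "\<And>F. F face_of integer_hull (J i) (K i) (B i) (b i) \<Longrightarrow> x $ i \<in> F \<Longrightarrow> real_vec p \<in> F"
        and g: "\<And>k. k < n \<Longrightarrow> g k \<in> graver_basis (J i) (K i) (B i)"
          "\<And>k l j. k < n \<Longrightarrow> l < n \<Longrightarrow> k \<noteq> l \<Longrightarrow> g k $ j = 0 \<or> g l $ j = 0"
          "\<And>k. k < n \<Longrightarrow> \<exists>\<epsilon>>0. x $ i + \<epsilon> *\<^sub>R real_vec (g k) \<in> integer_hull (J i) (K i) (B i) (b i)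
                      \<and> x $ i - \<epsilon> *\<^sub>R real_vec (g k) \<in> integer_hull (J i) (K i) (B i) (b i)"
        and dist: "l1_norm (x $ i - real_vec p) \<le> (\<Sum>k<n. real_of_int (l1_norm (g k)))"
        using graver_directions[OF xQ[of i]] by blast
      have "real_vec p \<in> F i" using face FQ by (simp add: Q)
      \<comment> \<open>\<open>p\<close> is a lattice point of the minimal face, so the nearest one,
        \<open>y $ i\<close>, is at least as close.\<close>
      then have "l1_norm (x $ i - y $ i) \<le> l1_norm (x $ i - real_vec p)" by (intro y_min) auto
      also note dist
      finally show ?thesis
        using g unfolding good_def two_sided_direction_def Q by blast
    qed
    then obtain n g where good: "\<And>i. good i (n i) (g i)" by metis
    have g: "\<And>i k. k < n i \<Longrightarrow> g i k \<in> graver_basis (J i) (K i) (B i)"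
      "\<And>i k l j. k < n i \<Longrightarrow> l < n i \<Longrightarrow> k \<noteq> l \<Longrightarrow> g i k $ j = 0 \<or> g i l $ j = 0"
      "\<And>i k. k < n i \<Longrightarrow> two_sided_direction (Q i) (x $ i) (real_vec (g i k))"
      "\<And>i. l1_norm (x $ i - y $ i) \<le> (\<Sum>k<n i. real_of_int (l1_norm (g i k)))"
      using good unfolding good_def by blast+
    have convQ: "convex (Q i)" for i by (simp add: Q convex_integer_hull)
    have nz: "g i k \<noteq> 0" if "k < n i" for i k using g(1)[OF that] by (simp add: graver_basis_def)
    have dims: "(\<Sum>i\<in>UNIV. n i) \<le> CARD('r)"
      by (rule vertex_directions_le[OF x_vertex convQ nz g(2,3)])
    have "l1_norm (x $ i - y $ i) \<le> real (n i) * real H" for i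
    proof -
      have "(\<Sum>k<n i. real_of_int (l1_norm (g i k))) \<le> (\<Sum>k<n i. real H)"
        using GHr g(1) by (intro sum_mono) blast
      then show ?thesis using g(4)[of i] by simp
    qed
    then have "(\<Sum>i\<in>UNIV. l1_norm (x $ i - y $ i)) \<le> real (\<Sum>i\<in>UNIV. n i) * real H"
      by (simp add: sum_mono sum_distrib_right)
    also have "\<dots> \<le> real CARD('r) * real H"
      using dims by (intro mult_right_mono) (simp_all only: of_nat_le_iff of_nat_0_le_iff)
    finally show ?thesis .
  qed

  define decomp where "decomp i n h \<longleftrightarrow> (\<forall>k<n. h k \<in> graver_basis (J i) (K i) (B i)) \<and>
      za i - ya i = (\<Sum>k<n. h k) \<and> (\<forall>I\<subseteq>{..<n}. conforms (\<Sum>k\<in>I. h k) (za i - ya i))"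
    for i and n :: nat and h
  have "\<exists>n h. decomp i n h" for i
    using graver_decomposition[OF int_points_diff[OF za(1)[of i] ya(1)[of i]]] unfolding decomp_def by metis
  then obtain n h where nh: "\<And>i. decomp i (n i) (h i)" by metis
  have h: "\<And>i k. k < n i \<Longrightarrow> h i k \<in> graver_basis (J i) (K i) (B i)"
    "\<And>i. za i - ya i = (\<Sum>k<n i. h i k)"
    and conf: "\<And>i I. I \<subseteq> {..<n i} \<Longrightarrow> conforms (\<Sum>k\<in>I. h i k) (za i - ya i)"
    using nh unfolding decomp_def by blast+
  define E where "E = (SIGMA i:(UNIV :: 'n set). {..<n i})"
  define V where "V = (\<lambda>(i, k). A i *v h i k)"
  have finE: "finite E" by (simp add: E_def)
  have sumV: "(\<Sum>e\<in>(SIGMA i:UNIV. I i). V e) = (\<Sum>i\<in>UNIV. A i *v (\<Sum>k\<in>I i. h i k))"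
    if "\<And>i. finite (I i)" for I
    using that by (simp add: V_def matrix_vector_mult_sum_right flip: sum.Sigma)
  have "card E + CARD('r) + 1 \<le> (CARD('r) + 1) * (2 * (CARD('r) * (D * H)) + 1) ^ CARD('r)"
  proof (rule zero_sum_free_card_le[OF finE])
    fix e k assume "e \<in> E"
    then obtain i l where e: "e = (i, l)" "l < n i" by (auto simp: E_def)
    have "real_vec (h i l) \<in> vecs_on (J i)"
      using h(1)[OF e(2)] by (auto simp: graver_basis_def int_kernel_def vecs_on_def)
    then have "\<bar>(real_mat (A i) *v real_vec (h i l)) $ k\<bar> \<le> real D * l1_norm (real_vec (h i l))"
      using AD by (rule matrix_vector_mult_bound)
    also have "\<dots> \<le> real D * real H"
      using GHr[OF h(1)[OF e(2)]] by (intro mult_left_mono) simp_all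
    finally have "real_of_int \<bar>V e $ k\<bar> \<le> real_of_int (int (D * H))"
      by (simp add: real_mat_mult e(1) V_def)
    then show "\<bar>V e $ k\<bar> \<le> int (D * H)" by (simp only: of_int_le_iff)
  next
    fix k
    have "(\<Sum>e\<in>E. V e) = (\<Sum>i\<in>UNIV. A i *v (za i - ya i))"
      unfolding E_def h(2) by (rule sumV) simp
    then have "real_vec (\<Sum>e\<in>E. V e) = (\<Sum>i\<in>UNIV. real_mat (A i) *v (z $ i - y $ i))"
      by (simp only: real_vec_sum za(2) ya(2) flip: real_mat_mult real_vec_diff)
    also have "\<dots> = (\<Sum>i\<in>UNIV. real_mat (A i) *v (z $ i)) - (\<Sum>i\<in>UNIV. real_mat (A i) *v (y $ i))"
      by (simp add: matrix_vector_mult_diff_distrib sum_subtractf)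
    \<comment> \<open>Both sides equal \<open>b0\<close>; this trades the unknown distance of
      \<open>z\<close> from \<open>y\<close> for the known one of \<open>x\<close> from
      \<open>y\<close>.\<close>
    also have "(\<Sum>i\<in>UNIV. real_mat (A i) *v (z $ i)) = (\<Sum>i\<in>UNIV. real_mat (A i) *v (x $ i))"
      using x zf by (simp add: ip_feasible_def lp_feasible_def)
    also have "\<dots> - (\<Sum>i\<in>UNIV. real_mat (A i) *v (y $ i)) = (\<Sum>i\<in>UNIV. real_mat (A i) *v (x $ i - y $ i))"
      by (simp add: matrix_vector_mult_diff_distrib sum_subtractf)
    finally have "\<bar>real_vec (\<Sum>e\<in>E. V e) $ k\<bar> = \<bar>\<Sum>i\<in>UNIV. (real_mat (A i) *v (x $ i - y $ i)) $ k\<bar>"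
      by simp
    also have "\<dots> \<le> (\<Sum>i\<in>UNIV. \<bar>(real_mat (A i) *v (x $ i - y $ i)) $ k\<bar>)" by (rule sum_abs)
    also have "\<dots> \<le> (\<Sum>i\<in>UNIV. real D * l1_norm (x $ i - y $ i))"
    proof (rule sum_mono)
      fix i
      have "x $ i \<in> vecs_on (J i)" "y $ i \<in> vecs_on (J i)"
        using xQ ya integer_hull_subset_vecs_on real_vec_in_integer_hull by fastforce+
      then have "x $ i - y $ i \<in> vecs_on (J i)" by (simp add: vecs_on_def)
      then show "\<bar>(real_mat (A i) *v (x $ i - y $ i)) $ k\<bar> \<le> real D * l1_norm (x $ i - y $ i)"
        using AD by (rule matrix_vector_mult_bound)
    qed
    also have "\<dots> \<le> real D * (real CARD('r) * real H)"
      using near by (simp add: mult_left_mono flip: sum_distrib_left)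
    finally have "real_of_int \<bar>(\<Sum>e\<in>E. V e) $ k\<bar> \<le> real_of_int (int (CARD('r) * (D * H)))"
      by (simp add: mult_ac)
    then show "\<bar>(\<Sum>e\<in>E. V e) $ k\<bar> \<le> int (CARD('r) * (D * H))" by (simp only: of_int_le_iff)
  next
    fix I assume I: "I \<subseteq> E" "I \<noteq> {}"
    define S where "S i = {k. (i, k) \<in> I}" for i
    have S: "S i \<subseteq> {..<n i}" for i using I(1) by (auto simp: S_def E_def)
    then have finS: "finite (S i)" for i using finite_subset by blast
    have IS: "I = (SIGMA i:UNIV. S i)" by (auto simp: S_def)
    show "(\<Sum>e\<in>I. V e) \<noteq> 0"
    proof
      assume "(\<Sum>e\<in>I. V e) = 0"
      then have "(\<Sum>i\<in>UNIV. A i *v (\<Sum>k\<in>S i. h i k)) = 0"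
        unfolding IS by (simp add: sumV finS)
      moreover have "(\<Sum>k\<in>S i. h i k) \<in> int_kernel (J i) (K i) (B i)" for i
        using S h(1) graver_basis_subset by (intro int_kernel_sum) blast
      \<comment> \<open>The images cancel only across blocks; the exchange argument turns this into
        vanishing sums within every block, where conformity forbids cancellation between nonzero
        Graver elements.\<close>
      ultimately have zero: "(\<Sum>k\<in>S i. h i k) = 0" for i
        using conforming_exchange_trivial[OF Q x_optimal F yF(1) z ya za, of "\<lambda>i. \<Sum>k\<in>S i. h i k" i]
          conf[OF S] by blast
      obtain i k where ik: "k \<in> S i" using I(2) by (auto simp: S_def)
      have kn: "k < n i" using ik S by auto
      have "h i k + (\<Sum>k\<in>S i - {k}. h i k) = 0"
        using sum.remove[OF finS ik, of "h i"] unfolding zero by (rule sym)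
      moreover have "conforms (h i k) (za i - ya i)" using conf[of "{k}" i] kn by simp
      moreover have "conforms (\<Sum>k\<in>S i - {k}. h i k) (za i - ya i)" using S by (intro conf) auto
      ultimately have "h i k = 0" using conforms_add_eq_0 by blast
      then show False using h(1)[OF kn] by (simp add: graver_basis_def)
    qed
  qed
  then have "real (card E * H) \<le> (2 * real CARD('r) * \<Delta> * G + 1) ^ (CARD('r) + 4)"
    using D H by (rule proximity_arith) simp
  moreover have "block_l1_norm (y - z) \<le> real (card E * H)"
  proof -
    have "l1_norm ((y - z) $ i) \<le> real (n i) * real H" for i
    proof -
      have "l1_norm (za i - ya i) \<le> (\<Sum>k<n i. l1_norm (h i k))" unfolding h(2) by (rule l1_norm_sum)
      also have "\<dots> \<le> (\<Sum>k<n i. int H)" using GH h(1) by (intro sum_mono) auto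
      finally have "l1_norm (za i - ya i) \<le> int (n i * H)" by simp
      then have "real_of_int (l1_norm (za i - ya i)) \<le> real_of_int (int (n i * H))" by (simp only: of_int_le_iff)
      moreover have "(y - z) $ i = - real_vec (za i - ya i)" by (simp add: ya(2) za(2) real_vec_diff)
      ultimately show ?thesis by simp
    qed
    then have "block_l1_norm (y - z) \<le> (\<Sum>i\<in>UNIV. real (n i) * real H)"
      unfolding block_l1_norm_def by (intro sum_mono) auto
    also have "\<dots> = real (card E * H)" by (simp add: E_def sum_distrib_right)
    finally show ?thesis .
  qed
  ultimately show ?thesis by linarith
qed

end
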